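(* Every graph $G$ with maximum degree at most $5$ has an acyclic $(\mathcal{S}_4\cap\mathcal{D}_1)^{(5)}$-colouring, i.e. a colouring $c:V(G)\to\{1,\dots,5\}$ such that each colour class induces a forest of maximum degree at most $4$, and for every two distinct colours $i,j$ the subgraph consisting of all edges joining a vertex of colour $i$ to a vertex of colour $j$ is acyclic.
   Context: All graphs are finite and simple. Colourings are not required to be proper. $\mathcal{S}_d$ is the class of graphs with maximum degree at most $d$ and $\mathcal{D}_1$ is the class of acyclic graphs. *)

theory Defs
  imports Main
begin

definition simple_graph :: "'a set \<Rightarrow> ('a \<Rightarrow> 'a \<Rightarrow> bool) \<Rightarrow> bool" where
  "simple_graph V E \<longleftrightarrow> finite V \<and> (\<forall>u v. E u v \<longrightarrow> u \<in> V \<and> v \<in> V)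
     \<and> (\<forall>u v. E u v \<longrightarrow> E v u) \<and> (\<forall>v. \<not> E v v)"

definition max_degree_le :: "'a set \<Rightarrow> ('a \<Rightarrow> 'a \<Rightarrow> bool) \<Rightarrow> nat \<Rightarrow> bool" where
  "max_degree_le V E d \<longleftrightarrow> (\<forall>v\<in>V. card {w\<in>V. E v w} \<le> d)"

definition has_cycle :: "'a set \<Rightarrow> ('a \<Rightarrow> 'a \<Rightarrow> bool) \<Rightarrow> bool" where
  "has_cycle V E \<longleftrightarrow> (\<exists>xs. 3 \<le> length xs \<and> distinct xs \<and> set xs \<subseteq> V
     \<and> (\<forall>i. Suc i < length xs \<longrightarrow> E (xs ! i) (xs ! Suc i)) \<and> E (last xs) (hd xs))"

definition acyclic_graph :: "'a set \<Rightarrow> ('a \<Rightarrow> 'a \<Rightarrow> bool) \<Rightarrow> bool" where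
  "acyclic_graph V E \<longleftrightarrow> \<not> has_cycle V E"

definition colour_class :: "'a set \<Rightarrow> ('a \<Rightarrow> nat) \<Rightarrow> nat \<Rightarrow> 'a set" where
  "colour_class V c i = {v\<in>V. c v = i}"

definition class_edges :: "('a \<Rightarrow> 'a \<Rightarrow> bool) \<Rightarrow> ('a \<Rightarrow> nat) \<Rightarrow> nat \<Rightarrow> 'a \<Rightarrow> 'a \<Rightarrow> bool" where
  "class_edges E c i u w \<longleftrightarrow> E u w \<and> c u = i \<and> c w = i"

definition bicolour_edges :: "('a \<Rightarrow> 'a \<Rightarrow> bool) \<Rightarrow> ('a \<Rightarrow> nat) \<Rightarrow> nat \<Rightarrow> nat \<Rightarrow> 'a \<Rightarrow> 'a \<Rightarrow> bool" where
  "bicolour_edges E c i j u w \<longleftrightarrow> E u w \<and> ((c u = i \<and> c w = j) \<or> (c u = j \<and> c w = i))"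

end

theory Submission
  imports Defs
begin

text \<open>Vertices are coloured one at a time, keeping every uncoloured vertex \<^emph>\<open>rainbow\<close>: its coloured
  neighbours have distinct colours. A rainbow vertex can receive any colour without closing a
  cycle, so the only obstacles are its uncoloured neighbours, which have to remain rainbow. If
  \<open>H\<close> is the graph on the uncoloured vertices and \<open>v\<close> has minimum degree \<open>d\<close> in \<open>H\<close>, these forbid
  at most \<open>d (5 - d)\<close> colours for \<open>v\<close>, which is less than 5 unless \<open>d\<close> is 2 or 3. In these cases one
  can colour \<open>v\<close> so that exactly one neighbour \<open>z\<close> of \<open>v\<close> in \<open>H\<close> stops being rainbow, and it then
  sees exactly one pair of equal colours. A single such defect is allowed: \<open>z\<close> is coloured next,
  and one checks that this can be done so that the defect vanishes or moves to another vertex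
  of small degree in \<open>H\<close>, possibly after recolouring a coloured vertex with distinctly coloured
  neighbours.

  The degree bound comes for free: a vertex that sees two different colours when it is coloured
  never ends up with five neighbours of its own colour, and vertices coloured earlier than that
  can be treated together with a neighbour.\<close>

section \<open>Neighbourhoods in a graph of maximum degree 5\<close>

locale degree5_graph =
  fixes V :: "'a set" and E :: "'a \<Rightarrow> 'a \<Rightarrow> bool"
  assumes simple: "simple_graph V E" and degree: "max_degree_le V E 5"
begin

definition nb :: "'a \<Rightarrow> 'a set" where
  "nb v = {w. E v w}"

lemma finite_V: "finite V"
  using simple by (simp add: simple_graph_def)

lemma nb_sub: "nb v \<subseteq> V"
  using simple by (auto simp: simple_graph_def nb_def)

lemma nb_V: "w \<in> nb v \<Longrightarrow> w \<in> V"
  using nb_sub by blast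

lemma nb_V': "w \<in> nb v \<Longrightarrow> v \<in> V"
  using simple by (auto simp: simple_graph_def nb_def)

lemma nb_sym: "w \<in> nb v \<longleftrightarrow> v \<in> nb w"
  using simple by (auto simp: simple_graph_def nb_def)

lemma nb_irrefl [simp]: "v \<notin> nb v"
  using simple by (auto simp: simple_graph_def nb_def)

lemma nb_neq: "w \<in> nb v \<Longrightarrow> w \<noteq> v"
  by auto

lemma finite_nb [simp]: "finite (nb v)"
  using finite_V nb_sub finite_subset by blast

lemma card_nb: "card (nb v) \<le> 5"
proof (cases "v \<in> V")
  case True
  moreover have "{w \<in> V. E v w} = nb v"
    using nb_sub by (auto simp: nb_def)
  ultimately show ?thesis
    using degree by (auto simp: max_degree_le_def)
next
  case False
  then have "nb v = {}"
    using nb_V' by blast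
  then show ?thesis by simp
qed

section \<open>Partial colourings, bad cycles and blocked colours\<close>

text \<open>A partial colouring is a function \<open>c\<close> into \<open>{0..5}\<close>, and the
  vertices of colour \<open>0\<close> are the uncoloured ones. Along a cycle that is monochromatic or
  alternates between two colours, vertices at distance two have equal colours, and conversely.
  A cycle is given by a periodic function.\<close>

definition bad_cycle :: "('a \<Rightarrow> nat) \<Rightarrow> nat \<Rightarrow> (nat \<Rightarrow> 'a) \<Rightarrow> bool" where
  "bad_cycle c n f \<longleftrightarrow> 3 \<le> n \<and> (\<forall>i. f (i + n) = f i) \<and> inj_on f {..<n}
     \<and> (\<forall>i. f (Suc i) \<in> nb (f i)) \<and> (\<forall>i. c (f (i + 2)) = c (f i)) \<and> (\<forall>i. c (f i) \<noteq> 0)"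

definition valid :: "('a \<Rightarrow> nat) \<Rightarrow> bool" where
  "valid c \<longleftrightarrow> (\<nexists>n f. bad_cycle c n f)"

definition cols_at :: "('a \<Rightarrow> nat) \<Rightarrow> 'a \<Rightarrow> 'a \<Rightarrow> nat set" where
  "cols_at c z a = c ` (nb a - {z}) - {0}"

text \<open>If colouring \<open>z\<close> with \<open>\<gamma>\<close> closes a bad cycle through its neighbour \<open>a\<close>, then
  \<open>\<gamma> \<in> block c z a\<close>.\<close>

definition block :: "('a \<Rightarrow> nat) \<Rightarrow> 'a \<Rightarrow> 'a \<Rightarrow> nat set" where
  "block c z a = {\<gamma>. \<gamma> \<noteq> 0 \<and> (\<exists>y \<in> nb a - {z}. c y = \<gamma> \<and> (\<gamma> \<noteq> c a \<longrightarrow> (\<exists>y' \<in> nb y - {a}. c y' = c a)))}"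

lemma block_cols: "block c z a \<subseteq> cols_at c z a"
  by (auto simp: block_def cols_at_def)

lemma bad_cycle_mono:
  assumes "bad_cycle c' n f" and "\<And>v. c' v \<noteq> 0 \<Longrightarrow> c v = c' v"
  shows "bad_cycle c n f"
  using assms by (simp add: bad_cycle_def)

lemma valid_uncolour: "valid c \<Longrightarrow> valid (c(z := 0))"
  unfolding valid_def using bad_cycle_mono[of "c(z := 0)" _ _ c] by (metis fun_upd_apply)

text \<open>The values of \<open>f\<close> depend only on the index modulo \<open>n\<close>, so any
  \<open>n\<close> consecutive indices run once through the cycle. This lets a cycle start at any of
  its vertices.\<close>

lemma bad_cycle_shift:
  assumes "bad_cycle c n f"
  shows "bad_cycle c n (\<lambda>i. f (i + k))"
proof -
  have per: "\<And>i. f (i + n) = f i" and n: "3 \<le> n"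
    and inj: "inj_on f {..<n}"
    using assms by (auto simp: bad_cycle_def)
  have per': "f (i mod n) = f i" for i
  proof -
    have "f (j + m * n) = f j" for j m
    proof (induction m)
      case (Suc m)
      have "f (j + Suc m * n) = f (j + m * n + n)" by (simp add: algebra_simps)
      then show ?case using Suc per by simp
    qed simp
    from this[of "i mod n" "i div n"] show ?thesis by simp
  qed
  have mod_cancel: "i = j" if "i < n" "j < n" "i \<le> j" "(i + k) mod n = (j + k) mod n" for i j
  proof -
    have "n dvd (j + k) - (i + k)"
      using that mod_eq_dvd_iff_nat[of "i + k" "j + k" n] by simp
    then have "n dvd j - i" by simp
    then show ?thesis using that nat_dvd_not_less[of "j - i" n] by linarith
  qed
  have "inj_on (\<lambda>i. f (i + k)) {..<n}"
  proof (rule inj_onI)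
    fix i j assume ij: "i \<in> {..<n}" "j \<in> {..<n}" and "f (i + k) = f (j + k)"
    then have "f ((i + k) mod n) = f ((j + k) mod n)"
      by (simp add: per')
    then have "(i + k) mod n = (j + k) mod n"
      using inj n by (auto dest!: inj_onD)
    then show "i = j"
      using mod_cancel[of i j] mod_cancel[of j i] ij by (metis lessThan_iff nat_le_linear)
  qed
  moreover have "f (i + n + k) = f (i + k)" for i
    using per[of "i + k"] by (simp add: algebra_simps)
  moreover have "f (Suc i + k) \<in> nb (f (i + k))" and "c (f (i + 2 + k)) = c (f (i + k))" for i
    using assms unfolding bad_cycle_def by (metis add_Suc, metis add.assoc add.commute)
  ultimately show ?thesis
    using assms unfolding bad_cycle_def by blast
qed

text \<open>A new bad cycle passes through \<open>z\<close>. The two neighbours of \<open>z\<close>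
  on it have equal colours, and following the cycle from \<open>z\<close> in either direction shows
  that \<gamma> lies in the block of both.\<close>

lemma valid_upd:
  assumes v: "valid c" and z: "c z = 0" and g: "\<gamma> \<noteq> 0"
    and ok: "\<And>a b. a \<in> nb z \<Longrightarrow> b \<in> nb z \<Longrightarrow> a \<noteq> b \<Longrightarrow> c a = c b \<Longrightarrow> c a \<noteq> 0
             \<Longrightarrow> \<gamma> \<notin> block c z a \<or> \<gamma> \<notin> block c z b"
  shows "valid (c(z := \<gamma>))"
  unfolding valid_def
proof (rule ccontr, simp, elim exE)
  let ?c = "c(z := \<gamma>)"
  fix n f0 assume f0: "bad_cycle ?c n f0"
  have "\<exists>k. f0 k = z"
  proof (rule ccontr)
    assume "\<nexists>k. f0 k = z"
    then have "bad_cycle c n f0"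
      using f0 by (simp add: bad_cycle_def)
    then show False using v by (auto simp: valid_def)
  qed
  then obtain k where k: "f0 k = z" by blast
  define f where "f = (\<lambda>i. f0 (i + k))"
  have "bad_cycle ?c n f"
    unfolding f_def using f0 by (rule bad_cycle_shift)
  then have n: "3 \<le> n" and per: "\<And>i. f (i + n) = f i" and inj: "inj_on f {..<n}"
    and edge: "\<And>i. f (Suc i) \<in> nb (f i)" and col: "\<And>i. ?c (f (i + 2)) = ?c (f i)"
    and nz: "\<And>i. ?c (f i) \<noteq> 0"
    by (auto simp: bad_cycle_def)
  have fz: "f 0 = z" "f n = z" "f (Suc n) = f 1"
    using k per[of 0] per[of 1] by (auto simp: f_def)
  have n1: "n - 1 = Suc (n - 2)" and n2: "n - 2 = Suc (n - 3)" and n3: "n - 1 = n - 3 + 2"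
    using n by simp_all
  have neq: "f i \<noteq> f j" if "i < n" "j < n" "i \<noteq> j" for i j
    using inj that by (auto dest: inj_onD)
  have neqz: "f i \<noteq> z" if "i < n" "0 < i" for i
    using neq[of i 0] that fz n by auto
  have col': "?c (f j) = ?c (f i)" if "j = i + 2" for i j
    using col that by simp
  have edge': "f j \<in> nb (f i)" if "j = Suc i" for i j
    using edge that by simp
  let ?a = "f 1" and ?b = "f (n - 1)"
  have a: "?a \<in> nb z" and b: "?b \<in> nb z"
    using edge'[of 1 0] edge'[of n "n - 1"] nb_sym fz n by auto
  have ab: "?a \<noteq> ?b" using neq[of 1 "n - 1"] n by simp
  have cab: "c ?a = c ?b"
    using col'[of "Suc n" "n - 1"] fz n neqz[of 1] neqz[of "n - 1"] by simp
  have ca: "c ?a \<noteq> 0" using nz[of 1] neqz[of 1] n by simp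
  have "\<gamma> \<in> block c z ?a"
  proof -
    have y: "f 2 \<in> nb ?a - {z}" using edge'[of 2 1] neqz[of 2] n by simp
    have cy: "c (f 2) = \<gamma>" using col'[of 2 0] neqz[of 2] n fz by simp
    have "\<exists>y'\<in>nb (f 2) - {?a}. c y' = c ?a" if "\<gamma> \<noteq> c ?a"
    proof -
      have c3: "?c (f 3) = c ?a" using col'[of 3 1] neqz[of 1] n by simp
      then have "f 3 \<noteq> z" using that by auto
      \<comment> \<open>In a triangle \<open>f 3\<close> would be \<open>z\<close>. On longer cycles
        \<open>f 1\<close> and \<open>f 3\<close> are distinct, as \<open>block\<close>
        requires.\<close>
      then have "n \<noteq> 3" using fz by auto
      then have "f 3 \<noteq> f 1" using neq[of 3 1] n by simp
      moreover have "f 3 \<in> nb (f 2)" using edge'[of 3 2] by simp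
      ultimately show ?thesis using c3 \<open>f 3 \<noteq> z\<close> by auto
    qed
    then show ?thesis using y cy g by (auto simp: block_def)
  qed
  \<comment> \<open>The same argument, running backwards along the cycle from
    \<open>f n = z\<close>.\<close>
  moreover have "\<gamma> \<in> block c z ?b"
  proof -
    have "f (n - 2) \<noteq> z" using neqz[of "n - 2"] n by simp
    then have y: "f (n - 2) \<in> nb ?b - {z}" using edge'[OF n1] neqz[of "n - 2"] n nb_sym by (metis DiffI \<open>f (n - 2) \<noteq> z\<close> singletonD)
    have cy: "c (f (n - 2)) = \<gamma>" using col'[of n "n - 2"] neqz[of "n - 2"] n fz by simp
    have "\<exists>y'\<in>nb (f (n - 2)) - {?b}. c y' = c ?b" if "\<gamma> \<noteq> c ?b"
    proof -
      have "?b \<noteq> z" using neqz[of "n - 1"] n by simp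
      then have c3: "?c (f (n - 3)) = c ?b" using col'[OF n3] by (metis fun_upd_other)
      then have "f (n - 3) \<noteq> z" using that by auto
      then have "n \<noteq> 3" using fz by auto
      then have "f (n - 3) \<noteq> ?b" using neq[of "n - 3" "n - 1"] n by simp
      moreover have "f (n - 3) \<in> nb (f (n - 2))" using edge'[OF n2] nb_sym by metis
      ultimately show ?thesis using c3 \<open>f (n - 3) \<noteq> z\<close> by auto
    qed
    then show ?thesis using y cy g by (auto simp: block_def)
  qed
  ultimately show False
    using ok[OF a b ab cab ca] by blast
qed


section \<open>Rainbow vertices, sole pairs and admissible states\<close>

definition unc :: "('a \<Rightarrow> nat) \<Rightarrow> 'a \<Rightarrow> 'a set" where
  "unc c v = {w \<in> nb v. c w = 0}"

definition udeg :: "('a \<Rightarrow> nat) \<Rightarrow> 'a \<Rightarrow> nat" where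
  "udeg c v = card (unc c v)"

definition cols :: "('a \<Rightarrow> nat) \<Rightarrow> 'a \<Rightarrow> nat set" where
  "cols c v = c ` nb v - {0}"

definition rainbow :: "('a \<Rightarrow> nat) \<Rightarrow> 'a \<Rightarrow> bool" where
  "rainbow c v \<longleftrightarrow> (\<forall>a\<in>nb v. \<forall>b\<in>nb v. a \<noteq> b \<longrightarrow> c a = c b \<longrightarrow> c a = 0)"

definition sole_pair :: "('a \<Rightarrow> nat) \<Rightarrow> 'a \<Rightarrow> 'a \<Rightarrow> 'a \<Rightarrow> bool" where
  "sole_pair c z v u \<longleftrightarrow> v \<in> nb z \<and> u \<in> nb z \<and> v \<noteq> u \<and> c v = c u \<and> c v \<noteq> 0
     \<and> (\<forall>a\<in>nb z. \<forall>b\<in>nb z. a \<noteq> b \<longrightarrow> c a = c b \<longrightarrow> c a \<noteq> 0 \<longrightarrow> a = v \<and> b = u \<or> a = u \<and> b = v)"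

definition near_rainbow :: "('a \<Rightarrow> nat) \<Rightarrow> 'a \<Rightarrow> bool" where
  "near_rainbow c z \<longleftrightarrow> rainbow c z \<or> (\<exists>v u. sole_pair c z v u)"

text \<open>The colours that a neighbour \<open>v\<close> of \<open>w\<close> must not receive. If \<open>v\<close> is the only uncoloured neighbour
  of \<open>w\<close>, there are none: colouring \<open>v\<close> creates at most one pair at \<open>w\<close>, and some colour for \<open>w\<close> is
  left since the pair blocks at most four.\<close>

definition forb :: "('a \<Rightarrow> nat) \<Rightarrow> 'a \<Rightarrow> nat set" where
  "forb c w = (if udeg c w \<le> 1 then {} else cols c w)"

text \<open>Safety persists when further vertices are coloured, and bounds the degree of \<open>v\<close> in its final
  colour class by 4.\<close>

definition safe :: "('a \<Rightarrow> nat) \<Rightarrow> 'a \<Rightarrow> bool" where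
  "safe c v \<longleftrightarrow> card (nb v) < 5 \<or> (\<exists>w\<in>nb v. c w \<noteq> 0 \<and> c w \<noteq> c v)"

definition partial_col :: "('a \<Rightarrow> nat) \<Rightarrow> bool" where
  "partial_col c \<longleftrightarrow> (\<forall>v. c v \<le> 5) \<and> valid c"

text \<open>The sets \<open>U\<close> and \<open>Z\<close> consist of the coloured vertices that need not be safe yet and of the
  uncoloured vertices that may violate the rainbow condition.\<close>

definition state :: "'a set \<Rightarrow> 'a set \<Rightarrow> ('a \<Rightarrow> nat) \<Rightarrow> bool" where
  "state U Z c \<longleftrightarrow> partial_col c \<and> (\<forall>v\<in>V - U. c v \<noteq> 0 \<longrightarrow> safe c v)
     \<and> (\<forall>w\<in>V - Z. c w = 0 \<longrightarrow> rainbow c w \<or> (udeg c w = 0 \<and> near_rainbow c w))"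

lemma finite_sets [simp]: "finite (unc c v)" "finite (cols c v)" "finite (cols_at c z a)" "finite (forb c v)"
  by (auto simp: unc_def cols_def cols_at_def forb_def)

lemma finite_block [simp]: "finite (block c z a)"
  by (rule finite_subset[OF block_cols]) simp

lemma sole_pair_sym: "sole_pair c z v u \<Longrightarrow> sole_pair c z u v"
  unfolding sole_pair_def by metis

lemma sole_pairD:
  "sole_pair c z v u \<Longrightarrow> a \<in> nb z \<Longrightarrow> b \<in> nb z \<Longrightarrow> a \<noteq> b \<Longrightarrow> c a = c b \<Longrightarrow> c a \<noteq> 0
    \<Longrightarrow> a = v \<and> b = u \<or> a = u \<and> b = v"
  unfolding sole_pair_def by metis

lemma rainbowD:
  "rainbow c z \<Longrightarrow> a \<in> nb z \<Longrightarrow> b \<in> nb z \<Longrightarrow> c a = c b \<Longrightarrow> c a \<noteq> 0 \<Longrightarrow> a = b"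
  unfolding rainbow_def by metis

lemma coloured_card: "card {w \<in> nb v. c w \<noteq> 0} + udeg c v = card (nb v)"
proof -
  have "nb v = {w \<in> nb v. c w \<noteq> 0} \<union> unc c v" "{w \<in> nb v. c w \<noteq> 0} \<inter> unc c v = {}"
    by (auto simp: unc_def)
  moreover have "finite {w \<in> nb v. c w \<noteq> 0}" "finite (unc c v)" by simp_all
  ultimately show ?thesis
    unfolding udeg_def using card_Un_disjoint[of "{w \<in> nb v. c w \<noteq> 0}" "unc c v"] by presburger
qed

lemma cols_image: "cols c v = c ` {w \<in> nb v. c w \<noteq> 0}"
  by (auto simp: cols_def)

lemma card_cols_rainbow: "rainbow c v \<Longrightarrow> card (cols c v) + udeg c v = card (nb v)"
  unfolding cols_image coloured_card[symmetric, of v c]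
  by (subst card_image) (force simp: inj_on_def rainbow_def, rule refl)

text \<open>Without \<open>u\<close> the coloured neighbours of \<open>z\<close> still show all
  colours, now injectively, so the pair costs exactly one colour.\<close>

lemma card_cols_pair:
  assumes "sole_pair c z v u"
  shows "card (cols c z) + udeg c z + 1 = card (nb z)"
proof -
  let ?K = "{w \<in> nb z. c w \<noteq> 0}"
  have vu: "v \<in> ?K" "u \<in> ?K" "v \<noteq> u" "c v = c u"
    using assms by (auto simp: sole_pair_def)
  have "cols c z = c ` (?K - {u})"
  proof -
    have v: "v \<in> ?K - {u}" using vu(1,3) by (metis DiffI singletonD)
    have "c x \<in> c ` (?K - {u})" if "x \<in> ?K" for x
    proof (cases "x = u")
      case True
      then show ?thesis using image_eqI[of "c x" c v, OF _ v] vu(4) by simp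
    next
      case False
      then show ?thesis using that by simp
    qed
    then have "c ` ?K \<subseteq> c ` (?K - {u})" by (rule image_subsetI)
    moreover have "c ` (?K - {u}) \<subseteq> c ` ?K" by (rule image_mono) (rule Diff_subset)
    ultimately show ?thesis unfolding cols_image by (rule equalityI)
  qed
  moreover have "inj_on c (?K - {u})"
  proof (rule inj_onI)
    fix x y assume "x \<in> ?K - {u}" "y \<in> ?K - {u}" "c x = c y"
    then show "x = y" using sole_pairD[OF assms, of x y] by blast
  qed
  ultimately have "card (cols c z) = card ?K - 1"
    using vu by (simp add: card_image)
  moreover have "card ?K > 0" using vu by (auto simp: card_gt_0_iff)
  ultimately show ?thesis
    using coloured_card[of z c] by linarith
qed

lemma cols_sub: "partial_col c \<Longrightarrow> cols c v \<subseteq> {1..5}"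
  by (auto simp: cols_def partial_col_def Suc_le_eq)

lemma cols_at_sub: "partial_col c \<Longrightarrow> cols_at c z a \<subseteq> {1..5}"
  by (auto simp: cols_at_def partial_col_def Suc_le_eq)

lemma card_others: "z \<in> nb a \<Longrightarrow> card (nb a - {z}) \<le> 4"
  using card_nb[of a] by simp

lemma card_cols_at: "z \<in> nb a \<Longrightarrow> card (cols_at c z a) \<le> 4"
proof -
  assume z: "z \<in> nb a"
  have "card (cols_at c z a) \<le> card (c ` (nb a - {z}))"
    unfolding cols_at_def by (intro card_mono) auto
  also have "\<dots> \<le> card (nb a - {z})" by (rule card_image_le) simp
  finally show ?thesis using card_others[OF z] by linarith
qed

text \<open>A rainbow vertex \<open>w\<close> sees at most \<open>5 - udeg c w\<close> colours, and
  \<open>forb c w\<close> is empty unless \<open>2 \<le> udeg c w\<close>. The last two parts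
  recover \<open>udeg c w\<close> from a large forbidden set.\<close>

lemma forb_cases:
  assumes "rainbow c w"
  shows "card (forb c w) \<le> 3" and "2 \<le> card (forb c w) \<Longrightarrow> udeg c w = 2 \<or> udeg c w = 3"
    and "3 \<le> card (forb c w) \<Longrightarrow> udeg c w = 2"
  using card_cols_rainbow[OF assms] card_nb[of w] by (auto simp: forb_def split: if_splits)

lemma forb_sub: "forb c w \<subseteq> cols c w"
  by (auto simp: forb_def)

lemma udeg_pos: "v \<in> unc c w \<Longrightarrow> udeg c w \<noteq> 0"
  by (auto simp: udeg_def card_gt_0_iff)

lemma unc_V: "w \<in> unc c v \<Longrightarrow> w \<in> V"
  using nb_V by (auto simp: unc_def)

section \<open>The effect of colouring one vertex\<close>

context
  fixes c :: "'a \<Rightarrow> nat" and v :: 'a and \<alpha> :: nat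
  assumes v0: "c v = 0" and a0: "\<alpha> \<noteq> (0::nat)"
begin

lemma unc_upd: "unc (c(v := \<alpha>)) w = unc c w - {v}"
  using a0 by (auto simp: unc_def)

lemma udeg_upd: "udeg (c(v := \<alpha>)) w = (if v \<in> nb w then udeg c w - 1 else udeg c w)"
proof -
  have "v \<in> nb w \<longleftrightarrow> v \<in> unc c w" using v0 by (simp add: unc_def)
  then show ?thesis
    unfolding udeg_def unc_upd by (simp add: card_Diff_singleton_if)
qed

lemma cols_upd: "cols (c(v := \<alpha>)) w = (if v \<in> nb w then insert \<alpha> (cols c w) else cols c w)"
proof -
  have "cols c w = c ` (nb w - {v}) - {0}"
    using v0 by (auto simp: cols_def)
  moreover have "cols (c(v := \<alpha>)) w = (if v \<in> nb w then {\<alpha>} else {}) \<union> (c ` (nb w - {v}) - {0})"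
    using a0 by (auto simp: cols_def)
  ultimately show ?thesis by auto
qed

lemma cols_at_upd: "cols_at (c(v := \<alpha>)) z a = (if v \<in> nb a - {z} then insert \<alpha> (cols_at c z a) else cols_at c z a)"
  using a0 v0 by (auto simp: cols_at_def image_iff)

lemma rainbow_upd:
  assumes "rainbow c w" and "v \<in> nb w \<Longrightarrow> \<alpha> \<notin> cols c w"
  shows "rainbow (c(v := \<alpha>)) w"
  unfolding rainbow_def
proof (intro ballI impI)
  fix a b assume ab: "a \<in> nb w" "b \<in> nb w" "a \<noteq> b" "(c(v := \<alpha>)) a = (c(v := \<alpha>)) b"
  have "c x \<noteq> \<alpha>" if "x \<in> nb w" "v \<in> nb w" for x
    using assms(2) a0 that by (auto simp: cols_def)
  then have "a \<noteq> v" "b \<noteq> v" using ab by (metis fun_upd_apply)+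
  then show "(c(v := \<alpha>)) a = 0"
    using ab assms(1) unfolding rainbow_def by (metis fun_upd_other)
qed

lemma sole_pair_upd:
  assumes "sole_pair c w a b" and "v \<in> nb w \<Longrightarrow> \<alpha> \<notin> cols c w"
  shows "sole_pair (c(v := \<alpha>)) w a b"
proof -
  have "v \<noteq> a" "v \<noteq> b" using assms v0 by (auto simp: sole_pair_def)
  moreover have "v \<in> nb w \<Longrightarrow> x \<in> nb w \<Longrightarrow> c x \<noteq> \<alpha>" for x
    using assms(2) a0 by (auto simp: cols_def)
  moreover have "x = a \<and> y = b \<or> x = b \<and> y = a"
    if xy: "x \<in> nb w" "y \<in> nb w" "x \<noteq> y" "(c(v := \<alpha>)) x = (c(v := \<alpha>)) y" "(c(v := \<alpha>)) x \<noteq> 0" for x y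
  proof -
    have "x \<noteq> v" "y \<noteq> v" using xy calculation(3) by (metis fun_upd_apply)+
    then show ?thesis using xy sole_pairD[OF assms(1), of x y] by (metis fun_upd_other)
  qed
  ultimately show ?thesis
    using assms(1) unfolding sole_pair_def by (metis fun_upd_other)
qed

text \<open>If \<alpha> already occurs at \<open>w\<close>, it occurs at a unique neighbour
  \<open>u\<close>, and this one forms the only pair with \<open>v\<close>.\<close>

lemma rainbow_upd_pair:
  assumes "rainbow c w"
  shows "rainbow (c(v := \<alpha>)) w \<or> (v \<in> nb w \<and> \<alpha> \<in> cols c w \<and> (\<exists>u. sole_pair (c(v := \<alpha>)) w v u))"
proof (cases "v \<in> nb w \<and> \<alpha> \<in> cols c w")
  case True
  then obtain u where u: "u \<in> nb w" "c u = \<alpha>" by (auto simp: cols_def)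
  have only_u: "x = u" if "x \<in> nb w" "c x = \<alpha>" for x
    using rainbowD[OF assms that(1) u(1)] that(2) u(2) a0 by simp
  have uv: "u \<noteq> v" using u v0 a0 by auto
  have sole: "x = v \<and> y = u \<or> x = u \<and> y = v"
    if xy: "x \<in> nb w" "y \<in> nb w" "x \<noteq> y" "(c(v := \<alpha>)) x = (c(v := \<alpha>)) y" "(c(v := \<alpha>)) x \<noteq> 0" for x y
  proof (cases "x = v \<or> y = v")
    case T: True
    then show ?thesis using only_u[of x] only_u[of y] xy by auto
  next
    case False
    then show ?thesis using xy rainbowD[OF assms xy(1,2)] by simp
  qed
  have "sole_pair (c(v := \<alpha>)) w v u"
    unfolding sole_pair_def
  proof (intro conjI ballI impI)
    show "v \<noteq> u" "v \<in> nb w" "u \<in> nb w" "(c(v := \<alpha>)) v = (c(v := \<alpha>)) u" "(c(v := \<alpha>)) v \<noteq> 0"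
      using uv True u a0 by simp_all
  qed (use sole in blast)
  then show ?thesis using True by blast
next
  case False
  then show ?thesis using rainbow_upd[OF assms] by blast
qed

lemma safe_upd: "safe c w \<Longrightarrow> w \<noteq> v \<Longrightarrow> safe (c(v := \<alpha>)) w"
  using v0 unfolding safe_def by (metis fun_upd_apply)

lemma safe_new:
  assumes "2 \<le> card (cols c v) \<or> card (nb v) < 5"
  shows "safe (c(v := \<alpha>)) v"
proof (cases "card (nb v) < 5")
  case False
  then have "2 \<le> card (cols c v)" using assms by simp
  then obtain b where "b \<in> cols c v" "b \<noteq> \<alpha>"
    by (metis card_le_Suc0_iff_eq finite_sets(2) not_less_eq_eq numeral_2_eq_2)
  then obtain w where "w \<in> nb v" "c w = b" "b \<noteq> 0" by (auto simp: cols_def)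
  then show ?thesis
    using \<open>b \<noteq> \<alpha>\<close> nb_neq[of w v] unfolding safe_def by (metis fun_upd_apply)
qed (simp add: safe_def)

text \<open>The general colouring step. An uncoloured neighbour of \<open>v\<close> outside
  \<open>Z'\<close> either stays rainbow, or \<open>v\<close> was its last uncoloured neighbour, in
  which case one pair is permitted.\<close>

lemma state_colour:
  assumes st: "state U Z c" and vV: "v \<in> V" and a5: "\<alpha> \<le> 5" and val: "valid (c(v := \<alpha>))"
    and sf: "v \<notin> U' \<Longrightarrow> safe (c(v := \<alpha>)) v" and ok: "\<And>w. w \<in> unc c v \<Longrightarrow> w \<notin> Z' \<Longrightarrow> \<alpha> \<notin> forb c w"
    and Z: "Z \<subseteq> insert v Z'" and U: "\<And>u. u \<in> U \<Longrightarrow> u \<notin> U' \<Longrightarrow> c u \<noteq> 0 \<Longrightarrow> safe (c(v := \<alpha>)) u"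
  shows "state U' Z' (c(v := \<alpha>))"
proof -
  let ?c = "c(v := \<alpha>)"
  have "rainbow ?c w \<or> (udeg ?c w = 0 \<and> near_rainbow ?c w)" if w: "w \<in> V" "w \<notin> Z'" "?c w = 0" for w
  proof -
    have wv: "w \<noteq> v" "c w = 0" using w a0 by (auto split: if_splits)
    then have old: "rainbow c w \<or> (udeg c w = 0 \<and> near_rainbow c w)"
      using st w Z by (auto simp: state_def)
    show ?thesis
    proof (cases "v \<in> nb w")
      case True
      then have vw: "v \<in> unc c w" "w \<in> unc c v" using v0 wv nb_sym by (auto simp: unc_def)
      \<comment> \<open>Before the step \<open>v\<close> is an uncoloured neighbour of
        \<open>w\<close>, which rules out the alternative \<open>udeg c w = 0\<close>.\<close>
      then have r: "rainbow c w" using old udeg_pos by blast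
      show ?thesis
      proof (cases "\<alpha> \<in> cols c w")
        case False
        then show ?thesis using rainbow_upd[OF r] by blast
      next
        case T: True
        have "udeg c w \<le> 1"
        proof (rule ccontr)
          assume "\<not> udeg c w \<le> 1"
          then have "forb c w = cols c w" by (simp add: forb_def)
          then show False using ok[OF vw(2) w(2)] T by simp
        qed
        then have "udeg ?c w = 0" using True by (simp add: udeg_upd)
        then show ?thesis using rainbow_upd_pair[OF r] by (auto simp: near_rainbow_def)
      qed
    next
      case False
      have "near_rainbow ?c w" if "near_rainbow c w"
        using that rainbow_upd[of w] sole_pair_upd[of w] False unfolding near_rainbow_def by metis
      then show ?thesis using old rainbow_upd[of w] False udeg_upd[of w] by metis
    qed
  qed
  then have Z1: "\<forall>w\<in>V - Z'. ?c w = 0 \<longrightarrow> rainbow ?c w \<or> (udeg ?c w = 0 \<and> near_rainbow ?c w)"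
    by simp
  have "safe ?c w" if w: "w \<in> V" "w \<notin> U'" "?c w \<noteq> 0" for w
  proof (cases "w = v")
    case True
    then show ?thesis using sf w by simp
  next
    case False
    then show ?thesis proof (cases "w \<in> U")
      case True
      then show ?thesis using U[of w] w \<open>w \<noteq> v\<close> by simp
    next
      case F: False
      have "safe c w" using st w F \<open>w \<noteq> v\<close> by (simp add: state_def)
      then show ?thesis using safe_upd \<open>w \<noteq> v\<close> by blast
    qed
  qed
  then have Z2: "\<forall>w\<in>V - U'. ?c w \<noteq> 0 \<longrightarrow> safe ?c w"
    by simp
  have Z3: "\<forall>x. ?c x \<le> 5" using st a5 by (simp add: state_def partial_col_def)
  show ?thesis
    unfolding state_def partial_col_def by (intro conjI Z1 Z2 Z3 val)
qed

lemma valid_rainbow: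
  assumes "valid c" "rainbow c v"
  shows "valid (c(v := \<alpha>))"
proof (rule valid_upd[OF assms(1) v0 a0])
  fix x y assume "x \<in> nb v" "y \<in> nb v" "x \<noteq> y" "c x = c y" "c x \<noteq> 0"
  then show "\<alpha> \<notin> block c v x \<or> \<alpha> \<notin> block c v y"
    using rainbowD[OF assms(2), of x y] by blast
qed

text \<open>A bad cycle through \<open>v\<close> has to use both vertices of the only pair, so only
  a colour blocked from both sides can close one.\<close>

lemma valid_pair:
  assumes "valid c" "sole_pair c v a b" "\<alpha> \<notin> block c v a \<inter> block c v b"
  shows "valid (c(v := \<alpha>))"
proof (rule valid_upd[OF assms(1) v0 a0])
  fix x y assume "x \<in> nb v" "y \<in> nb v" "x \<noteq> y" "c x = c y" "c x \<noteq> 0"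
  then have "x = a \<and> y = b \<or> x = b \<and> y = a" by (rule sole_pairD[OF assms(2)])
  then show "\<alpha> \<notin> block c v x \<or> \<alpha> \<notin> block c v y"
    using assms(3) by blast
qed

lemma card_uncoloured_upd:
  assumes "v \<in> V"
  shows "card {w \<in> V. (c(v := \<alpha>)) w = 0} < card {w \<in> V. c w = 0}"
proof (rule psubset_card_mono)
  have "v \<in> {w \<in> V. c w = 0}" "v \<notin> {w \<in> V. (c(v := \<alpha>)) w = 0}"
    using assms v0 a0 by simp_all
  moreover have "{w \<in> V. (c(v := \<alpha>)) w = 0} \<subseteq> {w \<in> V. c w = 0}"
    using v0 by auto
  ultimately show "{w \<in> V. (c(v := \<alpha>)) w = 0} \<subset> {w \<in> V. c w = 0}" by blast
qed (use finite_V in simp)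

end


section \<open>Recolouring a coloured vertex\<close>

lemma nb_cong:
  assumes "\<And>x. x \<in> nb w \<Longrightarrow> c' x = c x"
  shows "rainbow c' w = rainbow c w" "sole_pair c' w v u = sole_pair c w v u"
    "near_rainbow c' w = near_rainbow c w" "udeg c' w = udeg c w"
proof -
  show "rainbow c' w = rainbow c w"
    using assms unfolding rainbow_def by (simp cong: ball_cong)
  have *: "sole_pair c' w v u = sole_pair c w v u" for v u
  proof (cases "v \<in> nb w \<and> u \<in> nb w")
    case True
    then show ?thesis using assms unfolding sole_pair_def by (simp cong: ball_cong)
  next
    case False
    then show ?thesis by (auto simp: sole_pair_def)
  qed
  then show "sole_pair c' w v u = sole_pair c w v u" .
  show "near_rainbow c' w = near_rainbow c w"
    unfolding near_rainbow_def * using \<open>rainbow c' w = rainbow c w\<close> by simp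
  have "unc c' w = unc c w"
    using assms unfolding unc_def by (intro Collect_cong) auto
  then show "udeg c' w = udeg c w" by (simp add: udeg_def)
qed

text \<open>A rainbow vertex lies on no bad cycle whatever its own colour, so validity is kept. The
  uncoloured neighbours of \<open>u\<close> are covered by \<open>Z'\<close>. A coloured neighbour
  of colour other than \<open>e\<close> has \<open>u\<close> as a witness of its safety, and one of
  colour \<open>e\<close> gets another witness from \<open>tainted\<close>.\<close>

lemma state_recolour:
  assumes st: "state {} Z c" and u: "c u \<noteq> 0" "rainbow c u" and e: "e \<noteq> 0" "e \<le> 5"
    and safe_u: "\<exists>y\<in>nb u. c y \<noteq> 0 \<and> c y \<noteq> e"
    and tainted: "\<And>w. w \<in> nb u \<Longrightarrow> c w = e \<Longrightarrow> \<exists>y\<in>nb w - {u}. c y \<noteq> 0 \<and> c y \<noteq> e"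
    and Z: "Z \<subseteq> Z'" "unc c u \<subseteq> Z'"
  shows "state {} Z' (c(u := e))"
proof -
  let ?c = "c(u := e)"
  have "valid (c(u := 0))"
    using st valid_uncolour by (simp add: state_def partial_col_def)
  moreover have "rainbow (c(u := 0)) u"
    using u(2) nb_cong(1)[of u "c(u := 0)" c] nb_neq by (metis fun_upd_other)
  ultimately have "valid ((c(u := 0))(u := e))"
    using e valid_rainbow[of "c(u := 0)" u e] by simp
  then have val: "valid ?c" by simp
  have Z1: "rainbow ?c w \<or> (udeg ?c w = 0 \<and> near_rainbow ?c w)" if w: "w \<in> V - Z'" "?c w = 0" for w
  proof -
    have "w \<noteq> u" using w(2) e by auto
    then have cw: "c w = 0" using w(2) by simp
    have "u \<notin> nb w"
    proof
      assume "u \<in> nb w"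
      then have "w \<in> unc c u" using nb_sym cw by (simp add: unc_def)
      then show False using Z(2) w(1) by blast
    qed
    then have same: "\<And>x. x \<in> nb w \<Longrightarrow> ?c x = c x" by auto
    note cong = nb_cong[of w ?c c, OF same]
    have "w \<in> V - Z" using w Z(1) by blast
    then have "rainbow c w \<or> (udeg c w = 0 \<and> near_rainbow c w)"
      using st cw unfolding state_def by simp
    then show ?thesis using cong(1,3,4) by simp
  qed
  have Z2: "safe ?c w" if w: "w \<in> V - {}" "?c w \<noteq> 0" for w
  proof (cases "w = u")
    case True
    obtain y where y: "y \<in> nb u" "c y \<noteq> 0" "c y \<noteq> e" using safe_u by blast
    then have "?c y \<noteq> 0 \<and> ?c y \<noteq> ?c u" using nb_neq[of y u] by simp
    then show ?thesis unfolding safe_def True using y(1) by blast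
  next
    case False
    then have cw: "c w \<noteq> 0" using w by simp
    then have sf: "safe c w" using st w by (simp add: state_def)
    show ?thesis
    proof (cases "u \<in> nb w")
      case T: True
      show ?thesis
      proof (cases "c w = e")
        case True
        then obtain y where y: "y \<in> nb w - {u}" "c y \<noteq> 0" "c y \<noteq> e"
          using tainted[of w] T nb_sym by blast
        then have "?c y \<noteq> 0 \<and> ?c y \<noteq> ?c w" using True False by simp
        then show ?thesis using y(1) unfolding safe_def by blast
      next
        case F: False
        then have "?c u \<noteq> 0 \<and> ?c u \<noteq> ?c w" using e False by simp
        then show ?thesis using T unfolding safe_def by blast
      qed
    next
      case F: False
      then have *: "\<And>x. x \<in> nb w \<Longrightarrow> ?c x = c x" by auto
      show ?thesis
      proof (cases "card (nb w) < 5")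
        case True
        then show ?thesis by (simp add: safe_def)
      next
        case F5: False
        then obtain y where "y \<in> nb w" "c y \<noteq> 0" "c y \<noteq> c w" using sf by (auto simp: safe_def)
        then have "?c y \<noteq> 0 \<and> ?c y \<noteq> ?c w" using *[of y] False by simp
        then show ?thesis using \<open>y \<in> nb w\<close> unfolding safe_def by blast
      qed
    qed
  qed
  have "\<forall>x. ?c x \<le> 5" using st e by (simp add: state_def partial_col_def)
  then show ?thesis
    unfolding state_def partial_col_def using val Z1 Z2 by (intro conjI ballI impI) simp_all
qed

lemma state_drop:
  assumes "state U Z c" "\<And>w. w \<in> Z \<Longrightarrow> w \<notin> Z' \<Longrightarrow> w \<in> V \<Longrightarrow> c w = 0 \<Longrightarrow> rainbow c w \<or> (udeg c w = 0 \<and> near_rainbow c w)"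
  shows "state U Z' c"
  using assms unfolding state_def by blast

text \<open>The four neighbours of \<open>u\<close> other than \<open>z\<close> are coloured, with
  distinct colours, so \<open>u\<close> is rainbow and can take a colour missing at
  \<open>z\<close>, which dissolves the pair there. If \<open>e\<close> occurs at a neighbour of
  \<open>u\<close>, this neighbour is unique, and the block condition gives it a neighbour in the
  old colour of \<open>u\<close>, which keeps it safe.\<close>

lemma repair:
  assumes st: "state {} {z} c" and pr: "sole_pair c z v u" and z0: "c z = 0"
    and full: "card (cols_at c z u) = 4" and e: "e \<in> {1..5}" "e \<notin> cols c z"
    and blk: "e \<in> cols_at c z u \<Longrightarrow> e \<in> block c z u"
  shows "state {} {} (c(u := e))"
proof -
  let ?N = "nb u - {z}"
  have zu: "u \<in> nb z" "z \<in> nb u" "c u \<noteq> 0" using pr nb_sym by (auto simp: sole_pair_def)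
  have N4: "card ?N \<le> 4" using card_others zu by blast
  have le: "card (c ` ?N) \<le> card ?N" by (rule card_image_le) simp
  have "0 \<notin> c ` ?N"
  proof
    assume "0 \<in> c ` ?N"
    \<comment> \<open>An uncoloured vertex in \<open>?N\<close> would account for one of at most
      four values of \<open>c\<close>, leaving only three colours.\<close>
    then have "card (cols_at c z u) = card (c ` ?N) - 1"
      unfolding cols_at_def by (rule card_Diff_singleton)
    then show False using full le N4 by linarith
  qed
  then have C: "cols_at c z u = c ` ?N" unfolding cols_at_def by blast
  then have "card (c ` ?N) = 4" using full by simp
  then have "card (c ` ?N) = card ?N" using le N4 by linarith
  then have inj: "inj_on c ?N" by (intro eq_card_imp_inj_on) simp_all
  have nz: "c y \<noteq> 0" if "y \<in> ?N" for y using \<open>0 \<notin> c ` ?N\<close> that by force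
  have rb: "rainbow c u"
    unfolding rainbow_def
  proof (intro ballI impI, rule ccontr)
    fix a b assume ab: "a \<in> nb u" "b \<in> nb u" "a \<noteq> b" "c a = c b" "c a \<noteq> 0"
    then have "a \<in> ?N" "b \<in> ?N" using z0 by auto
    then show False using inj ab by (simp add: inj_on_def)
  qed
  have "\<not> card (cols_at c z u - {e}) = 0"
    using full by (cases "e \<in> cols_at c z u") simp_all
  then have "cols_at c z u - {e} \<noteq> {}" by (metis card.empty)
  then have sf: "\<exists>y\<in>nb u. c y \<noteq> 0 \<and> c y \<noteq> e" by (auto simp: cols_at_def)
  have ecu: "e \<noteq> c u" using e(2) zu by (auto simp: cols_def)
  have "state {} {z} (c(u := e))"
  proof (rule state_recolour[OF st zu(3) rb _ _ sf])
    fix w assume w: "w \<in> nb u" "c w = e"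
    then have wN: "w \<in> ?N" using z0 e by auto
    then have "e \<in> block c z u" using blk w C by blast
    then obtain y y' where y: "y \<in> ?N" "c y = e" "y' \<in> nb y - {u}" "c y' = c u"
      using ecu unfolding block_def by blast
    then have "y = w" using inj wN w by (simp add: inj_on_def)
    then show "\<exists>y\<in>nb w - {u}. c y \<noteq> 0 \<and> c y \<noteq> e" using y zu ecu by metis
  next
    show "unc c u \<subseteq> {z}"
    proof
      fix y assume "y \<in> unc c u"
      then show "y \<in> {z}" using nz[of y] by (auto simp: unc_def)
    qed
  qed (use e in auto)
  then show ?thesis
  proof (rule state_drop)
    fix w assume "w \<in> {z}"
    have "rainbow (c(u := e)) z"
      unfolding rainbow_def
    proof (intro ballI impI, rule ccontr)
      fix a b assume ab: "a \<in> nb z" "b \<in> nb z" "a \<noteq> b" "(c(u := e)) a = (c(u := e)) b" "(c(u := e)) a \<noteq> 0"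
      have ne: "c y \<noteq> e" if "y \<in> nb z" for y using e that by (auto simp: cols_def)
      then have au: "a \<noteq> u" "b \<noteq> u" using ab by (metis fun_upd_apply)+
      then have "c a = c b" "c a \<noteq> 0" using ab by simp_all
      then show False using sole_pairD[OF pr ab(1-3)] au by blast
    qed
    then show "rainbow (c(u := e)) w \<or> (udeg (c(u := e)) w = 0 \<and> near_rainbow (c(u := e)) w)"
      using \<open>w \<in> {z}\<close> by simp
  qed
qed

section \<open>Induction on the number of uncoloured vertices\<close>

definition completable :: bool where
  "completable \<longleftrightarrow> (\<exists>c. partial_col c \<and> (\<forall>v\<in>V. c v \<noteq> 0 \<and> safe c v))"

definition holes :: "('a \<Rightarrow> nat) \<Rightarrow> nat" where
  "holes c = card {w \<in> V. c w = 0}"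

text \<open>The bound on \<open>cols_at c z v\<close> leaves at least three colours for \<open>z\<close>. It holds when the defect
  was created by colouring \<open>v\<close>, as \<open>v\<close> then saw at most two colours.\<close>

definition defect :: "('a \<Rightarrow> nat) \<Rightarrow> 'a \<Rightarrow> bool" where
  "defect c z \<longleftrightarrow> state {} {z} c \<and> z \<in> V \<and> c z = 0 \<and>
    (\<exists>v u. sole_pair c z v u \<and> (udeg c z \<le> 1 \<or> udeg c z = 2 \<and> card (cols_at c z v) \<le> 2))"

text \<open>The induction hypothesis. States with and without a defect are treated together, since
  either case can lead to the other.\<close>

definition complete_below :: "nat \<Rightarrow> bool" where
  "complete_below n \<longleftrightarrow> (\<forall>c. holes c < n \<longrightarrow> state {} {} c \<or> (\<exists>z. defect c z) \<longrightarrow> completable)"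

lemma holes_upd: "v \<in> V \<Longrightarrow> c v = 0 \<Longrightarrow> \<alpha> \<noteq> 0 \<Longrightarrow> holes (c(v := \<alpha>)) < holes c"
  unfolding holes_def using card_uncoloured_upd by simp

lemma stateD:
  assumes "state U Z c"
  shows "partial_col c" "valid c"
    and "v \<in> V \<Longrightarrow> v \<notin> U \<Longrightarrow> c v \<noteq> 0 \<Longrightarrow> safe c v"
    and "w \<in> V \<Longrightarrow> w \<notin> Z \<Longrightarrow> c w = 0 \<Longrightarrow> rainbow c w \<or> (udeg c w = 0 \<and> near_rainbow c w)"
  using assms unfolding state_def partial_col_def by simp_all

lemma state_rainbow:
  assumes "state U Z c" "w \<in> unc c v" "w \<notin> Z" "c v = 0"
  shows "rainbow c w"
proof -
  have "v \<in> unc c w" using assms nb_sym by (auto simp: unc_def)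
  then have "udeg c w \<noteq> 0" by (rule udeg_pos)
  moreover have "c w = 0" using assms(2) by (simp add: unc_def)
  ultimately show ?thesis using stateD(4)[OF assms(1) unc_V[OF assms(2)] assms(3)] by simp
qed

text \<open>For steps that leave no defect: \<open>zok\<close> settles the vertices that were
  exceptional before, and \<open>ok\<close> the remaining uncoloured neighbours of
  \<open>v\<close>.\<close>

lemma harmless:
  assumes IH: "complete_below n" and h: "holes c \<le> n" and st: "state {} Z c"
    and v: "v \<in> V" "c v = 0" and a: "\<alpha> \<in> {1..5}" and val: "valid (c(v := \<alpha>))" and sf: "safe (c(v := \<alpha>)) v"
    and zok: "\<And>w. w \<in> Z \<Longrightarrow> w \<noteq> v \<Longrightarrow> rainbow (c(v := \<alpha>)) w \<or> (udeg (c(v := \<alpha>)) w = 0 \<and> near_rainbow (c(v := \<alpha>)) w)"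
    and ok: "\<And>w. w \<in> unc c v \<Longrightarrow> w \<notin> Z \<Longrightarrow> \<alpha> \<notin> forb c w"
  shows completable
proof -
  have a0: "\<alpha> \<noteq> 0" "\<alpha> \<le> 5" using a by auto
  have "state {} (Z - {v}) (c(v := \<alpha>))"
    by (rule state_colour[OF v(2) a0(1) st v(1) a0(2) val sf]) (use ok in \<open>auto simp: unc_def\<close>)
  then have "state {} {} (c(v := \<alpha>))"
    by (rule state_drop) (use zok in blast)
  moreover have "holes (c(v := \<alpha>)) < n" using holes_upd[of v c \<alpha>, OF v a0(1)] h by linarith
  ultimately show ?thesis using IH unfolding complete_below_def by blast
qed

text \<open>The exceptional vertex may also be rainbow, so it need not be known whether the defect
  survived.\<close>

lemma defect_done:
  assumes IH: "complete_below n" and h: "holes c < n" and st: "state {} {x} c" and x: "x \<in> V" "c x = 0"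
    and nr: "rainbow c x \<or> (\<exists>v u. sole_pair c x v u \<and> (udeg c x \<le> 1 \<or> udeg c x = 2 \<and> card (cols_at c x v) \<le> 2))"
  shows completable
proof (cases "rainbow c x")
  case True
  have "state {} {} c" by (rule state_drop[OF st]) (use True in blast)
  then show ?thesis using IH h unfolding complete_below_def by blast
next
  case False
  then have "defect c x" using st x nr unfolding defect_def by blast
  then show ?thesis using IH h unfolding complete_below_def by blast
qed

text \<open>For steps that damage at most the vertex \<open>x\<close>. The only pair at
  \<open>x\<close> then contains \<open>v\<close>, and \<open>x\<close> has lost one uncoloured
  neighbour, so \<open>ux\<close> is the condition of \<open>defect\<close> before that
  loss.\<close>

lemma harm:
  assumes IH: "complete_below n" and h: "holes c \<le> n" and st: "state {} Z c"
    and v: "v \<in> V" "c v = 0" and a: "\<alpha> \<in> {1..5}" and val: "valid (c(v := \<alpha>))" and sf: "safe (c(v := \<alpha>)) v"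
    and zok: "\<And>w. w \<in> Z \<Longrightarrow> w \<noteq> v \<Longrightarrow> rainbow (c(v := \<alpha>)) w \<or> (udeg (c(v := \<alpha>)) w = 0 \<and> near_rainbow (c(v := \<alpha>)) w)"
    and ok: "\<And>w. w \<in> unc c v \<Longrightarrow> w \<notin> Z \<Longrightarrow> w \<noteq> x \<Longrightarrow> \<alpha> \<notin> forb c w"
    and x: "x \<in> unc c v" "x \<notin> Z"
    and ux: "\<alpha> \<in> forb c x \<Longrightarrow> udeg c x = 2 \<or> udeg c x = 3 \<and> card (cols_at c x v) \<le> 2"
  shows completable
proof (cases "\<alpha> \<in> forb c x")
  case False
  show ?thesis
    by (rule harmless[OF IH h st v a val sf zok]) (use ok False in metis)+
next
  case True
  let ?c = "c(v := \<alpha>)"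
  have a0: "\<alpha> \<noteq> 0" "\<alpha> \<le> 5" using a by auto
  have "state {} ((Z - {v}) \<union> {x}) ?c"
    by (rule state_colour[OF v(2) a0(1) st v(1) a0(2) val sf]) (use ok in \<open>auto simp: unc_def\<close>)
  then have st': "state {} {x} ?c"
    by (rule state_drop) (use zok in blast)
  have rx: "rainbow c x" using state_rainbow[OF st x v(2)] .
  have xv: "v \<in> nb x" "x \<noteq> v" "c x = 0" "x \<in> V" using x(1) nb_sym unc_V[OF x(1)] by (auto simp: unc_def)
  have ud: "udeg ?c x = udeg c x - 1" using udeg_upd[of c v \<alpha> x, OF v(2) a0(1)] xv by simp
  have ca: "cols_at ?c x v = cols_at c x v" using cols_at_upd[of c v \<alpha> x v, OF v(2) a0(1)] by simp
  show ?thesis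
  proof (rule defect_done[OF IH _ st' xv(4)])
    show "holes ?c < n" using holes_upd[of v c \<alpha>, OF v a0(1)] h by linarith
    show "?c x = 0" using xv by simp
    have "udeg ?c x \<le> 1 \<or> udeg ?c x = 2 \<and> card (cols_at ?c x v) \<le> 2"
      using ux[OF True] unfolding ud ca by auto
    then show "rainbow ?c x \<or> (\<exists>v u. sole_pair ?c x v u \<and> (udeg ?c x \<le> 1 \<or> udeg ?c x = 2 \<and> card (cols_at ?c x v) \<le> 2))"
      using rainbow_upd_pair[of c v \<alpha> x, OF v(2) a0(1) rx] by blast
  qed
qed

text \<open>If its degree is 5, \<open>v\<close> sees at least 5 - 3 = 2 colours. For
  \<open>safe_pair\<close> the count is 5 - 2 - 1 = 2.\<close>

lemma safe_rainbow:
  assumes "rainbow c v" "udeg c v \<le> 3" "c v = 0" "\<alpha> \<noteq> 0"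
  shows "safe (c(v := \<alpha>)) v"
  using assms(2) card_cols_rainbow[OF assms(1)] by (intro safe_new[of c] assms(3,4)) linarith

lemma safe_pair:
  assumes "sole_pair c z v u" "udeg c z \<le> 2" "c z = 0" "\<alpha> \<noteq> 0"
  shows "safe (c(z := \<alpha>)) z"
  using assms(2) card_cols_pair[OF assms(1)] by (intro safe_new[of c] assms(3,4)) linarith

lemma exists_colour:
  assumes "finite S" "card S \<le> 4"
  shows "\<exists>\<alpha>\<in>{1..5::nat}. \<alpha> \<notin> S"
proof (rule ccontr)
  assume "\<not> ?thesis"
  then have "{1..5} \<subseteq> S" by blast
  then have "card {1..5::nat} \<le> card S" using assms(1) card_mono by blast
  then show False using assms(2) by simp
qed


section \<open>Colouring a vertex when there is no defect\<close>

text \<open>No uncoloured neighbour restricts the choice, and a vertex \<open>a\<close> of the pair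
  blocks at most four colours, as it has at most four neighbours besides \<open>v\<close>.\<close>

lemma colour_isolated:
  assumes IH: "complete_below n" and h: "holes c \<le> n" and st: "state {} {} c"
    and v: "v \<in> V" "c v = 0" and u0: "udeg c v = 0" and nr: "near_rainbow c v"
  shows completable
proof -
  have "\<exists>\<alpha>\<in>{1..5}. valid (c(v := \<alpha>)) \<and> safe (c(v := \<alpha>)) v"
  proof (cases "rainbow c v")
    case True
    then have "valid (c(v := 1)) \<and> safe (c(v := 1)) v"
      using valid_rainbow[of c v 1] safe_rainbow[of c v 1] v u0 stateD(2)[OF st] by simp
    then show ?thesis by force
  next
    case False
    then obtain a b where pr: "sole_pair c v a b" using nr by (auto simp: near_rainbow_def)
    then have "v \<in> nb a" using nb_sym by (auto simp: sole_pair_def)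
    have "card (block c v a) \<le> card (cols_at c v a)"
      by (rule card_mono[OF _ block_cols]) simp
    then have "card (block c v a) \<le> 4" using card_cols_at[OF \<open>v \<in> nb a\<close>, of c] by linarith
    then obtain \<alpha> where al: "\<alpha> \<in> {1..5}" "\<alpha> \<notin> block c v a" using exists_colour[of "block c v a"] by auto
    then have "valid (c(v := \<alpha>)) \<and> safe (c(v := \<alpha>)) v"
      using valid_pair[of c v \<alpha> a b] safe_pair[OF pr, of \<alpha>] v u0 pr stateD(2)[OF st] by simp
    then show ?thesis using al by blast
  qed
  then obtain \<alpha> where al: "\<alpha> \<in> {1..5}" "valid (c(v := \<alpha>))" "safe (c(v := \<alpha>)) v" by blast
  have "unc c v = {}" using u0 by (simp add: udeg_def)
  then show ?thesis
    using harmless[OF IH h st v al] by simp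
qed

lemma card_UN_le_mult:
  assumes "finite W" "\<And>w. w \<in> W \<Longrightarrow> card (f w) \<le> k"
  shows "card (\<Union>w\<in>W. f w) \<le> card W * k"
proof -
  have "card (\<Union>w\<in>W. f w) \<le> (\<Sum>w\<in>W. card (f w))" by (rule card_UN_le[OF assms(1)])
  also have "\<dots> \<le> (\<Sum>w\<in>W. k)" by (rule sum_mono) (use assms(2) in simp)
  finally show ?thesis by simp
qed

text \<open>Write d for \<open>udeg c v\<close>. If the uncoloured neighbours of \<open>v\<close>
  exclude all five colours, one of them, \<open>x\<close>, sees the maximal number 5 - d of colours,
  and the others exclude at most (d - 1)(5 - d) \<le> 4. A colour left over by them can damage
  \<open>x\<close> only.\<close>

lemma min_udeg_le_3:
  assumes IH: "complete_below n" and h: "holes c \<le> n" and st: "state {} {} c"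
    and v: "v \<in> V" "c v = 0" and min: "\<And>w. w \<in> V \<Longrightarrow> c w = 0 \<Longrightarrow> udeg c v \<le> udeg c w"
    and d: "udeg c v \<noteq> 0" "udeg c v \<le> 3"
  shows completable
proof -
  let ?W = "unc c v" and ?d = "udeg c v"
  let ?U = "\<Union>w\<in>?W. cols c w"
  have rv: "rainbow c v" using stateD(4)[OF st v(1) _ v(2)] d by simp
  have W: "rainbow c w" "?d \<le> udeg c w" "card (cols c w) \<le> 5 - udeg c w" "w \<in> V" "c w = 0" if "w \<in> ?W" for w
  proof -
    show "w \<in> V" "c w = 0" using that unc_V[OF that] by (auto simp: unc_def)
    then show "?d \<le> udeg c w" using min by simp
    show r: "rainbow c w" using state_rainbow[OF st that] v by simp
    show "card (cols c w) \<le> 5 - udeg c w" using card_cols_rainbow[OF r] card_nb[of w] by linarith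
  qed
  have dW: "card ?W = ?d" by (simp add: udeg_def)
  have dc: "?d = 1 \<or> ?d = 2 \<or> ?d = 3" using d by linarith
  have val: "valid (c(v := \<alpha>))" and sf: "safe (c(v := \<alpha>)) v" if "\<alpha> \<in> {1..5}" for \<alpha>
    using that valid_rainbow[of c v \<alpha>] safe_rainbow[OF rv d(2) v(2), of \<alpha>] rv v stateD(2)[OF st] by auto
  show ?thesis
  proof (cases "{1..5} \<subseteq> ?U")
    case False
    then obtain \<alpha> where al: "\<alpha> \<in> {1..5}" "\<alpha> \<notin> ?U" by blast
    show ?thesis
      by (rule harmless[OF IH h st v al(1) val[OF al(1)] sf[OF al(1)]])
        (use al forb_sub in blast)+
  next
    case True
    then have "card {1..5::nat} \<le> card ?U" by (intro card_mono) simp_all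
    then have U5: "5 \<le> card ?U" by simp
    \<comment> \<open>Otherwise \<open>?U\<close> would contain at most d (4 - d) \<le> 4
      colours.\<close>
    have "\<exists>x\<in>?W. 5 - ?d \<le> card (cols c x)"
    proof (rule ccontr)
      assume "\<not> ?thesis"
      then have "card (cols c w) \<le> 4 - ?d" if "w \<in> ?W" for w using that by force
      then have "card ?U \<le> ?d * (4 - ?d)" using card_UN_le_mult[of ?W "cols c" "4 - ?d"] dW by simp
      moreover have "?d * (4 - ?d) \<le> 4" using dc by (elim disjE) simp_all
      ultimately show False using U5 by linarith
    qed
    then obtain x where x: "x \<in> ?W" "5 - ?d \<le> card (cols c x)" by blast
    have ux: "udeg c x = ?d" using W(2,3)[OF x(1)] x(2) d by linarith
    let ?R = "\<Union>w\<in>?W - {x}. cols c w"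
    have "card (cols c w) \<le> 5 - ?d" if "w \<in> ?W" for w using W(2,3)[OF that] by linarith
    then have "card ?R \<le> card (?W - {x}) * (5 - ?d)" by (intro card_UN_le_mult) simp_all
    also have "card (?W - {x}) = ?d - 1" using x(1) dW by simp
    also have "(?d - 1) * (5 - ?d) \<le> 4" using dc by (elim disjE) simp_all
    finally have "card ?R \<le> 4" .
    then obtain \<alpha> where al: "\<alpha> \<in> {1..5}" "\<alpha> \<notin> ?R" using exists_colour[of ?R] by auto
    \<comment> \<open>For d = 3 this gives the bound of two that is demanded of a defect at
      \<open>x\<close>.\<close>
    have "card (cols c v) \<le> 5 - ?d" using card_cols_rainbow[OF rv] card_nb[of v] by linarith
    moreover have "cols_at c x v \<subseteq> cols c v" by (auto simp: cols_at_def cols_def)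
    ultimately have ca: "card (cols_at c x v) \<le> 5 - ?d"
      by (meson card_mono finite_sets(2) le_trans)
    show ?thesis
    proof (rule harm[OF IH h st v al(1) val[OF al(1)] sf[OF al(1)], where x = x])
      fix w assume "w \<in> unc c v" "w \<noteq> x"
      then show "\<alpha> \<notin> forb c w" using al(2) forb_sub by blast
    next
      assume "\<alpha> \<in> forb c x"
      then have "\<not> udeg c x \<le> 1" by (auto simp: forb_def)
      then show "udeg c x = 2 \<or> udeg c x = 3 \<and> card (cols_at c x v) \<le> 2"
        using ux d ca by auto
    qed (use x in simp_all)
  qed
qed

text \<open>Here d = \<open>udeg c v\<close> is 4 or 5 and d (5 - d) \<le> 4, so some colour
  \<alpha> is harmless to all uncoloured neighbours. Only the safety of \<open>v\<close> can fail,
  since \<open>v\<close> sees at most one colour.\<close>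

lemma min_udeg_ge_4:
  assumes IH: "complete_below n" and h: "holes c \<le> n" and st: "state {} {} c"
    and v: "v \<in> V" "c v = 0" and min: "\<And>w. w \<in> V \<Longrightarrow> c w = 0 \<Longrightarrow> udeg c v \<le> udeg c w"
    and d: "4 \<le> udeg c v"
  shows completable
proof -
  let ?W = "unc c v" and ?d = "udeg c v"
  let ?U = "\<Union>w\<in>?W. cols c w"
  have hole: "rainbow c w" "card (cols c w) \<le> 5 - udeg c w" "card (cols c w) \<le> 5 - ?d" if "w \<in> V" "c w = 0" for w
  proof -
    show r: "rainbow c w" using stateD(4)[OF st that(1) _ that(2)] min[OF that] d by simp
    show "card (cols c w) \<le> 5 - udeg c w" using card_cols_rainbow[OF r] card_nb[of w] by linarith
    then show "card (cols c w) \<le> 5 - ?d" using min[OF that] by linarith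
  qed
  have W: "w \<in> V" "c w = 0" if "w \<in> ?W" for w using that unc_V[OF that] by (auto simp: unc_def)
  have rv: "rainbow c v" using hole v by blast
  have dW: "card ?W = ?d" by (simp add: udeg_def)
  have d5: "?d \<le> 5" using card_cols_rainbow[OF rv] card_nb[of v] by linarith
  have "card ?U \<le> card ?W * (5 - ?d)" by (rule card_UN_le_mult) (use hole(3) W in auto)
  also have "\<dots> \<le> 4" unfolding dW using d d5 by (cases "?d = 4") auto
  finally have "card ?U \<le> 4" .
  then obtain \<alpha> where al: "\<alpha> \<in> {1..5}" "\<alpha> \<notin> ?U" using exists_colour[of ?U] by auto
  have val: "valid (c(v := \<alpha>))" if "\<alpha> \<in> {1..5}" for \<alpha>
    using that valid_rainbow[of c v \<alpha>] rv v stateD(2)[OF st] by auto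
  show ?thesis
  proof (cases "\<exists>\<beta>\<in>{1..5}. \<beta> \<notin> ?U \<and> safe (c(v := \<beta>)) v")
    case True
    then obtain \<beta> where b: "\<beta> \<in> {1..5}" "\<beta> \<notin> ?U" "safe (c(v := \<beta>)) v" by blast
    show ?thesis
      by (rule harmless[OF IH h st v b(1) val[OF b(1)] b(3)]) (use b forb_sub in blast)+
  next
    case unsafe: False
    txt \<open>Here \<open>v\<close> does not see a colour different from its own. We restore safety by colouring an
      uncoloured neighbour \<open>w1\<close> differently.\<close>
    let ?c = "c(v := \<alpha>)"
    have a0: "\<alpha> \<noteq> 0" "\<alpha> \<le> 5" using al by auto
    obtain w1 where w1: "w1 \<in> ?W" using dW d by (metis card.empty equals0I not_numeral_le_zero)
    have w1': "w1 \<in> V" "c w1 = 0" "w1 \<noteq> v" "v \<in> nb w1"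
      using W[OF w1] w1 nb_sym[of w1 v] by (auto simp: unc_def)
    have st1: "state {v} {} ?c"
    proof (rule state_colour[OF v(2) a0(1) st v(1) a0(2) val[OF al(1)]])
      fix w assume "w \<in> ?W"
      then show "\<alpha> \<notin> forb c w" using al(2) forb_sub by blast
    qed simp_all
    \<comment> \<open>The other uncoloured neighbours of \<open>w1\<close> exclude at most three
      colours, so together with \<alpha> at most four are lost. For d = 4, every harmless colour
      equals the single colour \<open>q\<close> seen by \<open>v\<close>, so the four uncoloured
      neighbours together see at least four colours. Each sees at most one, hence \<open>w1\<close>
      sees one and has at most four uncoloured neighbours, including \<open>v\<close>.\<close>
    have "card (unc c w1 - {v}) * (5 - ?d) \<le> 3"
    proof (cases "?d = 5")
      case False
      then have d4: "?d = 4" using d d5 by linarith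
      have nsafe: "\<not> safe (c(v := \<beta>)) v" if "\<beta> \<in> {1..5} - ?U" for \<beta>
        using unsafe that by blast
      have nb5: "card (nb v) = 5"
        using nsafe[of \<alpha>] al card_nb[of v] by (auto simp: safe_def)
      then have "card (cols c v) = 1" using card_cols_rainbow[OF rv] d4 by linarith
      then obtain q where q: "cols c v = {q}" by (auto simp: card_1_singleton_iff)
      then have "q \<in> cols c v" by simp
      then obtain y where y: "y \<in> nb v" "c y = q" "q \<noteq> 0" by (auto simp: cols_def)
      have "\<beta> = q" if "\<beta> \<in> {1..5} - ?U" for \<beta>
        using nsafe[OF that] y nb_neq[OF y(1)] by (auto simp: safe_def)
      then have "{1..5} \<subseteq> insert q ?U" by blast
      then have "card {1..5::nat} \<le> card (insert q ?U)" by (intro card_mono) simp_all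
      then have "4 \<le> card ?U" using card_insert_le_m1[of 5 ?U q] by (simp add: card_insert_if split: if_splits)
      moreover have "?U \<subseteq> (\<Union>w\<in>?W - {w1}. cols c w) \<union> cols c w1" by blast
      then have "card ?U \<le> card (\<Union>w\<in>?W - {w1}. cols c w) + card (cols c w1)"
        by (meson card_Un_le card_mono finite_Diff finite_UN finite_Un finite_sets(1,2) le_trans)
      moreover have "card (\<Union>w\<in>?W - {w1}. cols c w) \<le> card (?W - {w1}) * 1"
        by (rule card_UN_le_mult) (use hole(3) W d4 in auto)
      moreover have "card (?W - {w1}) = 3" using dW d4 w1 by simp
      ultimately have "1 \<le> card (cols c w1)" by linarith
      then have "udeg c w1 \<le> 4" using hole(2)[OF w1'(1,2)] by linarith
      moreover have "v \<in> unc c w1" using w1' v by (simp add: unc_def)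
      ultimately have "card (unc c w1 - {v}) \<le> 3" by (simp add: udeg_def)
      then show ?thesis using d4 by simp
    qed simp
    moreover have "card (\<Union>y\<in>unc c w1 - {v}. cols c y) \<le> card (unc c w1 - {v}) * (5 - ?d)"
      by (rule card_UN_le_mult) (use hole(3) unc_V in \<open>auto simp: unc_def\<close>)
    ultimately have "card (\<Union>y\<in>unc c w1 - {v}. cols c y) \<le> 3" by linarith
    then have "card (insert \<alpha> (\<Union>y\<in>unc c w1 - {v}. cols c y)) \<le> 4"
      by (simp add: card_insert_if)
    then obtain \<beta> where b: "\<beta> \<in> {1..5}" "\<beta> \<noteq> \<alpha>" "\<beta> \<notin> (\<Union>y\<in>unc c w1 - {v}. cols c y)"
      using exists_colour[of "insert \<alpha> (\<Union>y\<in>unc c w1 - {v}. cols c y)"] by auto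
    have b0: "\<beta> \<noteq> 0" "\<beta> \<le> 5" using b(1) by auto
    have c1w: "?c w1 = 0" using w1' by simp
    have rw: "rainbow ?c w1"
    proof (rule rainbow_upd[OF v(2) a0(1) hole(1)[OF w1'(1,2)]])
      show "\<alpha> \<notin> cols c w1" using al(2) w1 by blast
    qed
    have unc1: "unc ?c w1 = unc c w1 - {v}" using unc_upd[of c v \<alpha> w1] v a0 by simp
    have st2: "state {} {} (?c(w1 := \<beta>))"
    proof (rule state_colour[OF c1w b0(1) st1 w1'(1) b0(2)])
      show "valid (?c(w1 := \<beta>))"
        using valid_rainbow[of ?c w1 \<beta>] c1w b0 rw stateD(2)[OF st1] by blast
      have "(?c(w1 := \<beta>)) v = \<alpha>" "(?c(w1 := \<beta>)) w1 = \<beta>" using w1' by simp_all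
      then have "safe (?c(w1 := \<beta>)) w1" "safe (?c(w1 := \<beta>)) v"
        unfolding safe_def using w1'(4) nb_sym[of v w1] b(2) a0 b0 by metis+
      then show "safe (?c(w1 := \<beta>)) w1" "\<And>u. u \<in> {v} \<Longrightarrow> safe (?c(w1 := \<beta>)) u" by simp_all
      fix w assume w: "w \<in> unc ?c w1"
      then have "w \<in> unc c w1 - {v}" using unc1 by simp
      then have "\<beta> \<notin> cols c w" using b(3) by blast
      then have "\<beta> \<notin> cols ?c w" using cols_upd[of c v \<alpha> w] v a0 b(2) by auto
      then show "\<beta> \<notin> forb ?c w" using forb_sub by blast
    qed simp_all
    have "holes (?c(w1 := \<beta>)) < holes ?c" using holes_upd[of w1 ?c \<beta>] w1'(1) c1w b0 by blast
    moreover have "holes ?c < holes c" using holes_upd[of v c \<alpha>] v a0 by blast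
    ultimately have "holes (?c(w1 := \<beta>)) < n" using h by linarith
    then show ?thesis using IH st2 unfolding complete_below_def by blast
  qed
qed

lemma complete_no_defect:
  assumes IH: "complete_below n" and h: "holes c \<le> n" and st: "state {} {} c"
  shows completable
proof (cases "\<exists>v\<in>V. c v = 0")
  case False
  have "c v \<noteq> 0 \<and> safe c v" if "v \<in> V" for v
    using False that stateD(3)[OF st that] by simp
  then show ?thesis using stateD(1)[OF st] unfolding completable_def by blast
next
  case True
  let ?P = "\<lambda>v. v \<in> V \<and> c v = 0"
  define v where "v = arg_min (udeg c) ?P"
  have v: "v \<in> V" "c v = 0"
    using True arg_min_natI[of ?P _ "udeg c"] unfolding v_def by blast+
  have min: "udeg c v \<le> udeg c w" if "w \<in> V" "c w = 0" for w
    using that arg_min_nat_le[of ?P w "udeg c"] unfolding v_def by blast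
  consider "udeg c v = 0" | "udeg c v \<noteq> 0" "udeg c v \<le> 3" | "4 \<le> udeg c v" by linarith
  then show ?thesis
  proof cases
    case 1
    then have "near_rainbow c v"
      using stateD(4)[OF st v(1) _ v(2)] by (auto simp: near_rainbow_def)
    then show ?thesis using colour_isolated[OF IH h st v 1] by blast
  next
    case 2
    then show ?thesis using min_udeg_le_3[OF IH h st v min] by blast
  next
    case 3
    then show ?thesis using min_udeg_ge_4[OF IH h st v min] by blast
  qed
qed


section \<open>A defect with two uncoloured neighbours\<close>

text \<open>\<open>X\<close> and \<open>Y\<close> will be the forbidden sets of two uncoloured
  neighbours. A colour may hit one of them if that set has at least two elements, since
  \<open>forb_cases\<close> then controls the new defect. The only obstruction is that both sets
  coincide with \<open>T\<close>.\<close>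

lemma choose_from_three:
  fixes T X Y :: "'b set"
  assumes T: "finite T" "3 \<le> card T" and X: "finite X" "card X \<le> 3" and Y: "finite Y" "card Y \<le> 3"
  shows "(\<exists>\<beta>\<in>T. \<beta> \<notin> Y \<and> (\<beta> \<in> X \<longrightarrow> 2 \<le> card X)) \<or> (\<exists>\<beta>\<in>T. \<beta> \<notin> X \<and> (\<beta> \<in> Y \<longrightarrow> 2 \<le> card Y))
    \<or> (T = X \<and> T = Y)"
proof -
  have sub: "T = S" if "T \<subseteq> S" "finite S" "card S \<le> 3" for S :: "'b set"
    using card_seteq[OF that(2,1)] that(3) T(2) by linarith
  have big: "\<not> T \<subseteq> S" if "finite S" "card S < 3" for S :: "'b set"
    using card_mono[OF that(1)] that(2) T(2) by (meson not_le order_trans)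
  consider "2 \<le> card X" "2 \<le> card Y" | "card X < 2" "card Y < 2" | "card X < 2" "2 \<le> card Y" | "2 \<le> card X" "card Y < 2"
    by linarith
  then show ?thesis
  proof cases
    case 1
    then show ?thesis using sub[OF _ X] sub[OF _ Y] by blast
  next
    case 2
    then have "card (X \<union> Y) < 3" using card_Un_le[of X Y] by linarith
    then show ?thesis using big[of "X \<union> Y"] X Y by blast
  next
    case 3
    then show ?thesis using big[OF X(1)] by (metis less_trans numeral_less_iff semiring_norm(79) subsetI numeral_2_eq_2 numeral_3_eq_3 lessI)
  next
    case 4
    then show ?thesis using big[OF Y(1)] by (metis less_trans numeral_less_iff semiring_norm(79) subsetI numeral_2_eq_2 numeral_3_eq_3 lessI)
  qed
qed

text \<open>With \<open>x\<close> coloured like the pair, any two equally coloured neighbours of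
  \<open>z\<close> include \<open>v\<close> or \<open>u\<close>. Neither of these sees \<gamma>, so
  no bad cycle closes. The assumption \<open>\<gamma> \<noteq> c v\<close> covers the case that
  \<open>x\<close> is adjacent to one of them.\<close>

lemma valid_triple:
  assumes val: "valid (c(x := c v))" and pr: "sole_pair c z v u" and z0: "c z = 0" and x: "c x = 0" "x \<noteq> z"
    and g: "\<gamma> \<noteq> 0" "\<gamma> \<noteq> c v" "\<gamma> \<notin> cols_at c z v" "\<gamma> \<notin> cols_at c z u"
  shows "valid ((c(x := c v))(z := \<gamma>))"
proof -
  let ?c = "c(x := c v)"
  have p0: "c v \<noteq> 0" using pr by (simp add: sole_pair_def)
  have nv: "\<gamma> \<notin> block ?c z v" "\<gamma> \<notin> block ?c z u"
  proof -
    have "\<gamma> \<notin> cols_at ?c z v" "\<gamma> \<notin> cols_at ?c z u"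
      using cols_at_upd[of c x "c v" z v] cols_at_upd[of c x "c v" z u] x p0 g by auto
    then show "\<gamma> \<notin> block ?c z v" "\<gamma> \<notin> block ?c z u" using block_cols by blast+
  qed
  show ?thesis
  proof (rule valid_upd[OF val _ g(1)])
    show "?c z = 0" using z0 x by simp
    fix a b assume ab: "a \<in> nb z" "b \<in> nb z" "a \<noteq> b" "?c a = ?c b" "?c a \<noteq> 0"
    have "a = v \<or> a = u \<or> b = v \<or> b = u"
    proof (rule ccontr)
      assume n: "\<not> ?thesis"
      have cv: "v \<in> nb z" "c v = c v" using pr by (auto simp: sole_pair_def)
      show False
      proof (cases "a = x \<or> b = x")
        case False
        then show False using sole_pairD[OF pr ab(1-3)] ab(4,5) n by simp
      next
        case True
        then obtain y where "y \<in> nb z" "c y = c v" "y \<noteq> v" "y \<noteq> u"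
          using ab n by (metis fun_upd_apply)
        then show False using sole_pairD[OF pr \<open>y \<in> nb z\<close> cv(1)] p0 by simp
      qed
    qed
    then show "\<gamma> \<notin> block ?c z a \<or> \<gamma> \<notin> block ?c z b" using nv by blast
  qed
qed

lemma card_compl5: "B \<subseteq> {1..5::nat} \<Longrightarrow> card ({1..5} - B) = 5 - card B"
  by (simp add: card_Diff_subset finite_subset[OF _ finite_atLeastAtMost])

lemma two_unc:
  assumes "card W = 2" "x \<in> W"
  obtains y where "W = {x, y}" "y \<noteq> x"
  using assms by (metis card_2_iff insertE insert_commute singletonD)

text \<open>The colours unusable for \<open>u\<close> are those at \<open>z\<close> and those seen
  by \<open>u\<close> without being blocked, at most four in all. Recolouring \<open>u\<close> adds
  no uncoloured vertex, so \<open>complete_no_defect\<close> applies with the same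
  \<open>n\<close>.\<close>

lemma repair_complete:
  assumes IH: "complete_below n" and h: "holes c \<le> n" and st: "state {} {z} c"
    and z: "z \<in> V" "c z = 0" and pr: "sole_pair c z v u" and full: "card (cols_at c z u) = 4"
    and small: "card (cols c z) + card (cols_at c z u - block c z u) \<le> 4"
  shows completable
proof -
  have "card (cols c z \<union> (cols_at c z u - block c z u)) \<le> 4"
    using card_Un_le[of "cols c z" "cols_at c z u - block c z u"] small by linarith
  then obtain e where "e \<in> {1..5}" "e \<notin> cols c z \<union> (cols_at c z u - block c z u)"
    using exists_colour[of "cols c z \<union> (cols_at c z u - block c z u)"] by auto
  then have e: "e \<in> {1..5}" "e \<notin> cols c z" "e \<in> cols_at c z u \<Longrightarrow> e \<in> block c z u" by blast+
  have "state {} {} (c(u := e))" using repair[OF st pr z(2) full e] .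
  moreover have "holes (c(u := e)) \<le> holes c"
  proof -
    have "{w \<in> V. (c(u := e)) w = 0} \<subseteq> {w \<in> V. c w = 0}" using e(1) by auto
    then show ?thesis unfolding holes_def using finite_V by (intro card_mono) simp_all
  qed
  ultimately show ?thesis using complete_no_defect[OF IH _ ] h by (meson le_trans)
qed

text \<open>At most two colours are blocked at \<open>z\<close>, so at least three remain. Either
  one of them suits \<open>z\<close>, damaging at most one of its two uncoloured neighbours, or both
  neighbours forbid exactly the available colours. In this tight case all sizes are forced.\<close>

lemma defect_two:
  assumes IH: "complete_below n" and h: "holes c \<le> n" and st: "state {} {z} c"
    and z: "z \<in> V" "c z = 0" and pr: "sole_pair c z v u"
    and d: "udeg c z = 2" and small: "card (cols_at c z v) \<le> 2"
  shows completable
proof -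
  note pc = stateD(1)[OF st] and vc = stateD(2)[OF st]
  define p where "p = c v"
  have vu: "v \<in> nb z" "u \<in> nb z" "c u = p" "p \<noteq> 0" using pr by (auto simp: sole_pair_def p_def)
  have zu: "z \<in> nb u" "z \<in> nb v" using vu nb_sym by auto
  have pF: "p \<in> cols c z" using vu by (auto simp: cols_def p_def)
  have p5: "p \<in> {1..5}" using pF cols_sub[OF pc] by blast
  let ?B = "block c z v \<inter> block c z u"
  let ?A = "{1..5} - ?B"
  have B5: "?B \<subseteq> {1..5}" using block_cols cols_at_sub[OF pc] by blast
  have Bv: "?B \<subseteq> cols_at c z v" "?B \<subseteq> cols_at c z u" using block_cols by blast+
  have cB: "card ?B \<le> 2" using card_mono[OF finite_sets(3) Bv(1)] small by linarith
  have cA: "card ?A = 5 - card ?B" using card_compl5[OF B5] .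
  have cF: "card (cols c z) \<le> 2" using card_cols_pair[OF pr] d card_nb[of z] by linarith
  have valA: "valid (c(z := \<gamma>))" if "\<gamma> \<in> ?A" for \<gamma>
    using that valid_pair[of c z \<gamma> v u] z vc pr by auto
  obtain x1 x2 where W: "unc c z = {x1, x2}" "x1 \<noteq> x2"
    using d unfolding udeg_def by (meson card_2_iff)
  have W': "unc c z = {x2, x1}" unfolding W(1) by (rule insert_commute)
  have xs: "rainbow c x" "x \<in> V" "c x = 0" "x \<noteq> z" "z \<in> unc c x" if "x \<in> unc c z" for x
  proof -
    show "x \<in> V" using unc_V[OF that] .
    show "c x = 0" "x \<noteq> z" using that nb_neq[of x z] by (auto simp: unc_def)
    then show "rainbow c x" using state_rainbow[OF st that] z by simp
    show "z \<in> unc c x" using that nb_sym[of x z] z by (auto simp: unc_def)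
  qed
  have harm_z: completable
    if "\<gamma> \<in> ?A" "\<gamma> \<notin> forb c y" "\<gamma> \<in> forb c x \<longrightarrow> 2 \<le> card (forb c x)" "unc c z = {x, y}" for \<gamma> x y
  proof (rule harm[OF IH h st z _ valA[OF that(1)], where x = x])
    show "\<gamma> \<in> {1..5}" using that by blast
    show "safe (c(z := \<gamma>)) z" using safe_pair[OF pr _ z(2), of \<gamma>] d that(1) by auto
    show "\<gamma> \<notin> forb c w" if "w \<in> unc c z" "w \<noteq> x" for w using that \<open>unc c z = {x, y}\<close> \<open>\<gamma> \<notin> forb c y\<close> by blast
    have xz: "x \<in> unc c z" using that by blast
    then show "x \<in> unc c z" "x \<notin> {z}" using xs(4) by auto
    assume "\<gamma> \<in> forb c x"
    then have "udeg c x = 2 \<or> udeg c x = 3" using that(3) forb_cases(2)[OF xs(1)[OF xz]] by blast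
    moreover have "cols_at c x z \<subseteq> cols c z" by (auto simp: cols_at_def cols_def)
    then have "card (cols_at c x z) \<le> 2" using cF card_mono[OF finite_sets(2)] le_trans by blast
    ultimately show "udeg c x = 2 \<or> udeg c x = 3 \<and> card (cols_at c x z) \<le> 2" by blast
  qed simp
  have x12: "x1 \<in> unc c z" "x2 \<in> unc c z" using W by auto
  have "(\<exists>\<gamma>\<in>?A. \<gamma> \<notin> forb c x2 \<and> (\<gamma> \<in> forb c x1 \<longrightarrow> 2 \<le> card (forb c x1)))
      \<or> (\<exists>\<gamma>\<in>?A. \<gamma> \<notin> forb c x1 \<and> (\<gamma> \<in> forb c x2 \<longrightarrow> 2 \<le> card (forb c x2)))
      \<or> (?A = forb c x1 \<and> ?A = forb c x2)"
    using forb_cases(1)[OF xs(1)[OF x12(1)]] forb_cases(1)[OF xs(1)[OF x12(2)]] cA cB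
    by (intro choose_from_three) simp_all
  then have "completable \<or> (?A = forb c x1 \<and> ?A = forb c x2)"
  proof (elim disjE bexE conjE)
    fix \<gamma> assume "\<gamma> \<in> ?A" "\<gamma> \<notin> forb c x2" "\<gamma> \<in> forb c x1 \<longrightarrow> 2 \<le> card (forb c x1)"
    then show ?thesis using harm_z[OF _ _ _ W(1)] by simp
  next
    fix \<gamma> assume "\<gamma> \<in> ?A" "\<gamma> \<notin> forb c x1" "\<gamma> \<in> forb c x2 \<longrightarrow> 2 \<le> card (forb c x2)"
    then show ?thesis using harm_z[OF _ _ _ W'] by simp
  qed simp
  then show ?thesis
  proof (elim disjE)
    assume "?A = forb c x1 \<and> ?A = forb c x2"
    then have eq: "?A = forb c x1" "?A = forb c x2" by blast+
    have "card ?A \<le> 3" unfolding eq(1) by (rule forb_cases(1)[OF xs(1)[OF x12(1)]])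
    then have A3: "card ?A = 3" using cA cB by linarith
    then have B2: "card ?B = 2" using cA by linarith
    have Bv_eq: "?B = cols_at c z v"
      using card_seteq[OF finite_sets(3) Bv(1)] small B2 by simp
    have "card (forb c x1) = 3" "card (forb c x2) = 3"
      using arg_cong[OF eq(1), of card] arg_cong[OF eq(2), of card] A3 by linarith+
    then have ux: "udeg c x1 = 2" "udeg c x2 = 2"
      using forb_cases(3)[OF xs(1)[OF x12(1)]] forb_cases(3)[OF xs(1)[OF x12(2)]] by simp_all
    obtain w1 where w1: "unc c x1 = {z, w1}" "w1 \<noteq> z"
      using two_unc[OF _ xs(5)[OF x12(1)]] ux(1) unfolding udeg_def by metis
    have w1r: "rainbow c w1" using state_rainbow[OF st, of w1 x1] w1 xs(3)[OF x12(1)] by blast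
    have x1: "x1 \<in> V" "c x1 = 0" "x1 \<noteq> z" "rainbow c x1" "x1 \<in> nb z"
      using xs[OF x12(1)] x12 by (auto simp: unc_def)
    have valx: "valid (c(x1 := \<alpha>))" and safex: "safe (c(x1 := \<alpha>)) x1" if "\<alpha> \<in> {1..5}" for \<alpha>
      using that valid_rainbow[of c x1 \<alpha>] safe_rainbow[OF x1(4) _ x1(2), of \<alpha>] vc x1 ux by auto
    show ?thesis
    \<comment> \<open>A colour outside both sets can be given to \<open>x1\<close>, and the defect
      at \<open>z\<close> persists with one uncoloured neighbour. Otherwise the sets, of sizes at
      most 2 and 3, partition the five colours, so \<open>p\<close> is not forbidden at
      \<open>w1\<close>.\<close>
    proof (cases "{1..5} \<subseteq> cols c z \<union> forb c w1")
      case False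
      then obtain \<alpha> where al: "\<alpha> \<in> {1..5}" "\<alpha> \<notin> cols c z" "\<alpha> \<notin> forb c w1" by blast
      have a0: "\<alpha> \<noteq> 0" "\<alpha> \<le> 5" using al by auto
      have "state {} {z} (c(x1 := \<alpha>))"
        by (rule state_colour[OF x1(2) a0(1) st x1(1) a0(2) valx[OF al(1)] safex[OF al(1)]]) (use w1 al in auto)
      moreover have "sole_pair (c(x1 := \<alpha>)) z v u"
        using sole_pair_upd[of c x1 \<alpha> z v u] x1 a0 pr al by blast
      moreover have "udeg (c(x1 := \<alpha>)) z \<le> 1"
        using udeg_upd[of c x1 \<alpha> z] x1 a0 d by simp
      moreover have "(c(x1 := \<alpha>)) z = 0" using x1 z by simp
      moreover have "holes (c(x1 := \<alpha>)) < n" using holes_upd[of x1 c \<alpha>] x1 a0 h by linarith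
      ultimately show ?thesis using defect_done[OF IH _ _ z(1)] by blast
    next
      case True
      then have "card {1..5::nat} \<le> card (cols c z \<union> forb c w1)" by (intro card_mono) simp_all
      moreover have "card (cols c z \<union> forb c w1) + card (cols c z \<inter> forb c w1) = card (cols c z) + card (forb c w1)"
        using card_Un_Int[of "cols c z" "forb c w1"] by simp
      ultimately have "card (cols c z \<inter> forb c w1) = 0"
        using cF forb_cases(1)[OF w1r] by (simp only: card_atLeastAtMost)
      then have disj: "cols c z \<inter> forb c w1 = {}" by simp
      show ?thesis
      proof (cases "card (cols_at c z u) = 4")
        case T: True
        \<comment> \<open>The two colours in \<open>?B\<close> are blocked, so at most two of the
          four colours seen by \<open>u\<close> are unusable, and at most two more occur at
          \<open>z\<close>.\<close>
        have "cols_at c z u - block c z u \<subseteq> cols_at c z u - ?B" by blast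
        then have "card (cols_at c z u - block c z u) \<le> card (cols_at c z u - ?B)"
          by (intro card_mono) simp_all
        also have "\<dots> = 4 - 2" using T B2 Bv(2) by (simp add: card_Diff_subset)
        finally show ?thesis using repair_complete[OF IH h st z pr T] cF by linarith
      next
        case F: False
        then have c3: "card (cols_at c z u) \<le> 3" using card_cols_at[OF zu(1), of c] by linarith
        \<comment> \<open>\<open>?B\<close> takes two of the at most three colours seen by
          \<open>u\<close>. So \<open>?A\<close>, of size 3, has a colour besides \<open>p\<close>
          that \<open>u\<close> does not see, and \<open>v\<close> sees only colours in
          \<open>?B\<close>.\<close>
        have "?A \<inter> (cols_at c z u) \<subseteq> cols_at c z u - ?B" by blast
        then have "card (?A \<inter> cols_at c z u) \<le> card (cols_at c z u - ?B)"
          by (intro card_mono) simp_all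
        also have "\<dots> \<le> 1" using c3 B2 Bv(2) by (simp add: card_Diff_subset)
        finally have "card (insert p (?A \<inter> cols_at c z u)) \<le> 2"
          using card_insert_le_m1[of 2 "?A \<inter> cols_at c z u" p] by simp
        then have "\<not> ?A \<subseteq> insert p (?A \<inter> cols_at c z u)"
          using A3 card_mono[of "insert p (?A \<inter> cols_at c z u)" ?A] by auto
        then obtain \<gamma> where g: "\<gamma> \<in> ?A" "\<gamma> \<noteq> p" "\<gamma> \<notin> cols_at c z u" by blast
        then have gv: "\<gamma> \<notin> cols_at c z v" using Bv_eq by blast
        have g5: "\<gamma> \<in> {1..5}" "\<gamma> \<noteq> 0" using g by auto
        txt \<open>Now \<open>z\<close> sees \<open>p\<close> three times, but two of these neighbours, \<open>v\<close> and \<open>u\<close>, do not see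
          \<open>\<gamma>\<close>, so colouring \<open>z\<close> with \<open>\<gamma>\<close> closes no cycle.\<close>
        let ?c = "c(x1 := p)"
        have cz: "?c z = 0" using z x1 by simp
        have st1: "state {} {z} ?c"
          by (rule state_colour[OF x1(2) vu(4) st x1(1) _ valx[OF p5] safex[OF p5]])
            (use w1 disj pF p5 in auto)
        have val2: "valid (?c(z := \<gamma>))"
          using valid_triple[of c x1 v z u \<gamma>] valx[OF p5] pr z x1 g5 g gv unfolding p_def by blast
        have "2 \<le> card (cols ?c z) \<or> card (nb z) < 5"
        proof -
          have "cols c z \<subseteq> cols ?c z" using cols_upd[of c x1 p z] x1 vu by auto
          then have "card (cols c z) \<le> card (cols ?c z)" by (intro card_mono) simp_all
          then show ?thesis using card_cols_pair[OF pr] d by linarith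
        qed
        then have sf: "safe (?c(z := \<gamma>)) z" using safe_new[of ?c z \<gamma>] cz g5 by blast
        have unc1: "unc ?c z = {x2}" using unc_upd[of c x1 p z] x1 vu W by auto
        have ud2: "udeg ?c x2 \<le> 2" using udeg_upd[of c x1 p x2] x1 vu ux by simp
        show ?thesis
        proof (rule harm[OF IH _ st1 z(1) cz g5(1) val2 sf, where x = x2])
          show "holes ?c \<le> n" using holes_upd[of x1 c p] x1 vu h by linarith
          show "udeg ?c x2 = 2 \<or> udeg ?c x2 = 3 \<and> card (cols_at ?c x2 z) \<le> 2" if "\<gamma> \<in> forb ?c x2"
            using that ud2 by (auto simp: forb_def split: if_splits)
        qed (use unc1 xs(4)[OF x12(2)] in auto)
      qed
    qed
  qed
qed


section \<open>A defect with one uncoloured neighbour\<close>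

lemma defect_one:
  assumes IH: "complete_below n" and h: "holes c \<le> n" and st: "state {} {z} c"
    and z: "z \<in> V" "c z = 0" and pr: "sole_pair c z v u" and d: "udeg c z = 1"
  shows completable
proof (rule ccontr)
  assume contra: "\<not> completable"
  note pc = stateD(1)[OF st] and vc = stateD(2)[OF st]
  define p where "p = c v"
  have vu: "v \<in> nb z" "u \<in> nb z" "c u = p" "p \<noteq> 0" using pr by (auto simp: sole_pair_def p_def)
  have zu: "z \<in> nb u" "z \<in> nb v" using vu nb_sym by auto
  have pF: "p \<in> cols c z" using vu by (auto simp: cols_def p_def)
  have p5: "p \<in> {1..5}" using pF cols_sub[OF pc] by blast
  let ?B = "block c z v \<inter> block c z u"
  let ?A = "{1..5} - ?B"
  let ?D = "{1..5} - cols c z"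
  have B5: "?B \<subseteq> {1..5}" using block_cols cols_at_sub[OF pc] by blast
  have Bvu: "?B \<subseteq> cols_at c z v" "?B \<subseteq> cols_at c z u" using block_cols by blast+
  have cA: "card ?A = 5 - card ?B" using card_compl5[OF B5] .
  have cD: "card ?D = 5 - card (cols c z)" using card_compl5[OF cols_sub[OF pc]] .
  have cF: "card (cols c z) \<le> 3" using card_cols_pair[OF pr] d card_nb[of z] by linarith

  \<comment> \<open>If three colours are blocked and a vertex \<open>w\<close> of the pair sees a
    fourth, then at most 3 + 1 colours are unusable for recolouring \<open>w\<close>. Hence
    \<open>w\<close> sees exactly the blocked colours.\<close>
  have full_blocked: "cols_at c z w = ?B \<and> card ?B = 3"
    if w: "sole_pair c z w' w" "?B \<subseteq> cols_at c z w" "?B \<subseteq> block c z w" "z \<in> nb w" and B3: "3 \<le> card ?B" for w w'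
  proof -
    have "card (cols_at c z w) \<noteq> 4"
    proof
      assume c4: "card (cols_at c z w) = 4"
      have "card (cols_at c z w - block c z w) \<le> card (cols_at c z w - ?B)"
        using w(3) by (intro card_mono) auto
      also have "\<dots> \<le> 1" using c4 w(2) B3 by (simp add: card_Diff_subset)
      finally have "card (cols c z) + card (cols_at c z w - block c z w) \<le> 4" using cF by linarith
      then show False using repair_complete[OF IH h st z w(1) c4] contra by blast
    qed
    then have "card (cols_at c z w) \<le> 3" using card_cols_at[OF w(4), of c] by linarith
    moreover have "card ?B \<le> card (cols_at c z w)" using w(2) by (rule card_mono[rotated]) simp
    ultimately show ?thesis
      using card_seteq[OF finite_sets(3) w(2)] B3 by auto
  qed
  have Bu: "cols_at c z u = ?B" "card ?B = 3" if "3 \<le> card ?B"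
    using full_blocked[OF pr Bvu(2) _ zu(1) that] by blast+
  have Bv: "cols_at c z v = ?B" if "3 \<le> card ?B"
    using full_blocked[OF sole_pair_sym[OF pr] Bvu(1) _ zu(2) that] by blast
  have B3: "card ?B \<le> 3" using Bu(2) by linarith

  have valA: "valid (c(z := \<gamma>))" if "\<gamma> \<in> ?A" for \<gamma>
    using that valid_pair[of c z \<gamma> v u] z vc pr by auto
  have safeA: "safe (c(z := \<gamma>)) z" if "\<gamma> \<noteq> 0" for \<gamma>
    using safe_pair[OF pr _ z(2) that] d by simp
  obtain x where W: "unc c z = {x}" using d unfolding udeg_def by (meson card_1_singletonE)
  then have xW: "x \<in> unc c z" by simp
  have x: "x \<in> V" "c x = 0" "x \<noteq> z" "x \<in> nb z" "z \<in> unc c x" "rainbow c x" "z \<in> nb x"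
    using xW unc_V[OF xW] nb_neq[of x z] nb_sym[of x z] z state_rainbow[OF st xW] by (auto simp: unc_def)
  \<comment> \<open>A colour of \<open>?A\<close> that spares \<open>x\<close>, or leaves it with a
    single uncoloured neighbour, could be given to \<open>z\<close>.\<close>
  have blocked_x: "\<gamma> \<in> forb c x \<and> udeg c x \<noteq> 2" if g: "\<gamma> \<in> ?A" for \<gamma>
  proof (rule ccontr)
    assume n: "\<not> ?thesis"
    have g5: "\<gamma> \<in> {1..5}" "\<gamma> \<noteq> 0" using g by auto
    have completable
      by (rule harm[OF IH h st z g5(1) valA[OF g] safeA[OF g5(2)], where x = x]) (use n W x in auto)
    then show False using contra by blast
  qed
  then have "?A \<subseteq> forb c x" by blast
  then have cAx: "card ?A \<le> card (forb c x)" by (intro card_mono) simp_all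
  then have f2: "2 \<le> card (forb c x)" using cA B3 by linarith
  have "card ?A \<noteq> 0" using cA B3 by linarith
  then have "?A \<noteq> {}" by (metis card.empty)
  then obtain \<gamma>0 where "\<gamma>0 \<in> ?A" by blast
  then have ux: "udeg c x = 3" using forb_cases(2)[OF x(6) f2] blocked_x by blast
  then have fx: "forb c x = cols c x" by (simp add: forb_def)
  have cx: "card (cols c x) \<le> 2" using card_cols_rainbow[OF x(6)] ux card_nb[of x] by linarith
  then have "card ?A \<le> 2" using cAx fx by simp
  \<comment> \<open>The bounds meet: \<open>x\<close> sees exactly the colours available at
    \<open>z\<close>, while \<open>v\<close> and \<open>u\<close> see exactly the blocked
    ones.\<close>
  then have A2: "card ?A = 2" "card ?B = 3" using cA B3 by linarith+
  have Ax: "?A = cols c x" using card_seteq[OF finite_sets(2), of ?A c x] \<open>?A \<subseteq> forb c x\<close> fx cx A2 by simp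
  note Bu = Bu[unfolded A2, OF order_refl] and Bv = Bv[unfolded A2, OF order_refl]

  have "card (unc c x - {z}) = 2" using ux x(5) by (simp add: udeg_def)
  then obtain y1 y2 where Y: "unc c x - {z} = {y1, y2}" "y1 \<noteq> y2" by (meson card_2_iff)
  have Wx: "unc c x = {z, y1, y2}" using Y(1) x(5) by blast
  have ys: "rainbow c y" "y \<in> V" "c y = 0" "y \<noteq> z" "y \<noteq> x" "x \<in> unc c y" "y \<notin> nb z" "y \<in> unc c x" "y \<in> nb x"
    if "y \<in> {y1, y2}" for y
  proof -
    have "y \<in> unc c x - {z}" using that Y(1) by blast
    then show yx: "y \<in> unc c x" "y \<noteq> z" by blast+
    show "y \<in> V" using unc_V[OF yx(1)] .
    show "c y = 0" "y \<noteq> x" "y \<in> nb x" using yx nb_neq[of y x] by (auto simp: unc_def)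
    then show "x \<in> unc c y" using nb_sym[of x y] x by (simp add: unc_def)
    show "rainbow c y" using state_rainbow[OF st yx(1)] yx(2) x(2) by simp
    show "y \<notin> nb z" using W \<open>c y = 0\<close> \<open>y \<noteq> x\<close> by (auto simp: unc_def)
  qed
  have valx: "valid (c(x := \<alpha>))" and safex: "safe (c(x := \<alpha>)) x" if "\<alpha> \<in> {1..5}" for \<alpha>
    using that valid_rainbow[of c x \<alpha>] safe_rainbow[OF x(6) _ x(2), of \<alpha>] vc x ux by auto

  \<comment> \<open>A colour in \<open>?D\<close> leaves just the pair at \<open>z\<close>, which is
    allowed once \<open>z\<close> has no uncoloured neighbour. The colour \<open>p\<close> makes a
    triple there, so \<open>z\<close> is coloured at once, with a colour that neither
    \<open>v\<close> nor \<open>u\<close> sees.\<close>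
  have colour_x: False
    if b: "\<beta> \<in> insert p ?D" "\<beta> \<notin> forb c y'" "\<beta> \<in> forb c y \<longrightarrow> 2 \<le> card (forb c y)"
      and yy: "{y, y'} = {y1, y2}" for \<beta> y y'
  proof -
    have y: "y \<in> {y1, y2}" using yy by blast
    have b5: "\<beta> \<in> {1..5}" using b(1) p5 by blast
    have b0: "\<beta> \<noteq> 0" "\<beta> \<le> 5" using b5 by auto
    have Wyy: "unc c x = {z, y, y'}" using Wx yy by blast
    have uy: "udeg c y = 2 \<or> udeg c y = 3" if "\<beta> \<in> forb c y"
      using that b(3) forb_cases(2)[OF ys(1)[OF y]] by blast
    have "cols_at c y x \<subseteq> cols c x" by (auto simp: cols_at_def cols_def)
    then have cyx: "card (cols_at c y x) \<le> 2" using cx card_mono[OF finite_sets(2)] le_trans by blast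
    let ?c = "c(x := \<beta>)"
    have uz: "udeg ?c z = 0" using udeg_upd[of c x \<beta> z] x b0 d by simp
    have completable
    proof (cases "\<beta> \<in> ?D")
      case True
      have "sole_pair ?c z v u" using sole_pair_upd[of c x \<beta> z v u] x b0 pr True by blast
      then have "near_rainbow ?c z" by (auto simp: near_rainbow_def)
      then show ?thesis
        by (intro harm[OF IH h st x(1,2) b5 valx[OF b5] safex[OF b5], where x = y])
          (use uz Wyy b(2) ys[OF y] cyx uy in auto)
    next
      case False
      then have bp: "\<beta> = p" using b(1) by blast
      have "\<not> ?A \<subseteq> {p}" using A2(1) card_mono[of "{p}" ?A] by auto
      then obtain \<gamma> where g: "\<gamma> \<in> ?A" "\<gamma> \<noteq> p" by blast
      have g5: "\<gamma> \<in> {1..5}" "\<gamma> \<noteq> 0" "\<gamma> \<le> 5" using g by auto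
      let ?d = "?c(z := \<gamma>)"
      have cz: "?c z = 0" using z x by simp
      have st1: "state {} {z, y} ?c"
        by (rule state_colour[OF x(2) b0(1) st x(1) b0(2) valx[OF b5] safex[OF b5]])
          (use Wyy b(2) in auto)
      have "\<gamma> \<notin> cols_at c z v" "\<gamma> \<notin> cols_at c z u" using g Bu Bv by blast+
      then have val2: "valid ?d"
        using valid_triple[of c x v z u \<gamma>] valx[OF b5] pr z x g5 g unfolding bp p_def by blast
      have "2 \<le> card (cols ?c z) \<or> card (nb z) < 5"
      proof -
        have "cols c z \<subseteq> cols ?c z" using cols_upd[of c x \<beta> z] x b0 by auto
        then have "card (cols c z) \<le> card (cols ?c z)" by (intro card_mono) simp_all
        then show ?thesis using card_cols_pair[OF pr] d by linarith
      qed
      then have sf: "safe ?d z" using safe_new[of ?c z \<gamma>] cz g5 by blast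
      have "unc ?c z = {}" using uz by (simp add: udeg_def)
      then have st2: "state {} {y} ?d"
        by (intro state_colour[OF cz g5(2) st1 z(1) g5(3) val2 sf]) auto
      have yd: "?d y = 0" using ys[OF y] by simp
      have zy: "z \<notin> nb y" using ys(7)[OF y] nb_sym by blast
      have "rainbow ?d y \<or> (\<exists>a b. sole_pair ?d y a b \<and> (udeg ?d y \<le> 1 \<or> udeg ?d y = 2 \<and> card (cols_at ?d y a) \<le> 2))"
        using rainbow_upd_pair[of c x \<beta> y, OF x(2) b0(1) ys(1)[OF y]]
      proof (elim disjE conjE exE)
        assume "rainbow ?c y"
        then show ?thesis using rainbow_upd[of ?c z \<gamma> y] cz g5 zy by blast
      next
        fix b' assume bc: "\<beta> \<in> cols c y" "sole_pair ?c y x b'"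
        then have sp: "sole_pair ?d y x b'" using sole_pair_upd[of ?c z \<gamma> y x b'] cz g5 zy by blast
        have "udeg ?d y = udeg c y - 1"
          using udeg_upd[of ?c z \<gamma> y] udeg_upd[of c x \<beta> y] cz g5 b0 zy x(2) ys(9)[OF y] nb_sym[of x y] by simp
        moreover have "udeg c y \<le> 1 \<or> udeg c y = 2 \<or> udeg c y = 3"
          using uy bc(1) by (auto simp: forb_def)
        moreover have "cols_at ?d y x \<subseteq> insert \<gamma> (cols_at ?c y x)"
          using cols_at_upd[of ?c z \<gamma> y x] cz g5 by auto
        then have "cols_at ?d y x \<subseteq> insert \<gamma> (cols c x)"
          using cols_at_upd[of c x \<beta> y x] x(2) b0 by (auto simp: cols_at_def cols_def)
        \<comment> \<open>As \<gamma> lies in \<open>?A\<close>, which equals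
          \<open>cols c x\<close>, colouring \<open>z\<close> adds no new colour at
          \<open>x\<close>.\<close>
        then have "cols_at ?d y x \<subseteq> cols c x" using g(1) Ax by blast
        then have "card (cols_at ?d y x) \<le> 2" using cx card_mono[OF finite_sets(2)] le_trans by blast
        ultimately have "udeg ?d y \<le> 1 \<or> udeg ?d y = 2 \<and> card (cols_at ?d y x) \<le> 2" by auto
        then show ?thesis using sp by blast
      qed
      moreover have "holes ?d < n"
        using holes_upd[of x c \<beta>] holes_upd[of z ?c \<gamma>] x b0 z(1) cz g5 h by (meson le_trans less_le_trans less_trans)
      ultimately show ?thesis using defect_done[OF IH _ st2 ys(2)[OF y] yd] by blast
    qed
    then show False using contra by blast
  qed

  have pD: "p \<notin> ?D" using pF by blast
  have cT: "card (insert p ?D) = Suc (card ?D)" using pD by (simp del: Diff_iff)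
  have y12: "y1 \<in> {y1, y2}" "y2 \<in> {y1, y2}" by auto
  \<comment> \<open>\<open>?D\<close> alone may have only two colours. Admitting \<open>p\<close>
    provides the third.\<close>
  have "(\<exists>\<beta>\<in>insert p ?D. \<beta> \<notin> forb c y2 \<and> (\<beta> \<in> forb c y1 \<longrightarrow> 2 \<le> card (forb c y1)))
      \<or> (\<exists>\<beta>\<in>insert p ?D. \<beta> \<notin> forb c y1 \<and> (\<beta> \<in> forb c y2 \<longrightarrow> 2 \<le> card (forb c y2)))
      \<or> (insert p ?D = forb c y1 \<and> insert p ?D = forb c y2)"
    using forb_cases(1)[OF ys(1)[OF y12(1)]] forb_cases(1)[OF ys(1)[OF y12(2)]] cT cD cF
    by (intro choose_from_three) simp_all
  then have T: "insert p ?D = forb c y1" "insert p ?D = forb c y2"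
    using colour_x[of _ y2 y1] colour_x[of _ y1 y2] insert_commute[of y1 y2 "{}"] by blast+
  have "card (insert p ?D) \<le> 3" unfolding T(1) by (rule forb_cases(1)[OF ys(1)[OF y12(1)]])
  then have D2: "card ?D = 2" "card (cols c z) = 3" using cT cD cF by linarith+
  have "card (forb c y1) = 3" "card (forb c y2) = 3"
    using arg_cong[OF T(1), of card] arg_cong[OF T(2), of card] cT D2 by linarith+
  then have uy: "udeg c y1 = 2" "udeg c y2 = 2"
    using forb_cases(3)[OF ys(1)[OF y12(1)]] forb_cases(3)[OF ys(1)[OF y12(2)]] by simp_all
  note y1 = ys[OF y12(1)] and y2 = ys[OF y12(2)]
  obtain w where w: "unc c y1 = {x, w}" "w \<noteq> x"
    using two_unc[OF _ y1(6)] uy(1) unfolding udeg_def by metis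
  have wz: "w \<noteq> z" using w(1) y1(7) nb_sym[of z y1] by (auto simp: unc_def)
  have wr: "rainbow c w" using state_rainbow[OF st, of w y1] w y1(3) wz by blast
  have valy: "valid (c(y1 := \<alpha>))" and safey: "safe (c(y1 := \<alpha>)) y1" if "\<alpha> \<in> {1..5}" for \<alpha>
    using that valid_rainbow[of c y1 \<alpha>] safe_rainbow[OF y1(1) _ y1(3), of \<alpha>] vc y1(1,3) uy by auto
  have zy1: "y1 \<notin> nb z" using y1(7) .
  \<comment> \<open>Any other colour could be given to \<open>y1\<close>, which leaves
    \<open>x\<close> rainbow and keeps the defect at \<open>z\<close>. The sizes 2 and at most 3
    then make the two sets disjoint, so no colour seen by \<open>x\<close> is forbidden at
    \<open>w\<close>.\<close>
  have "{1..5} \<subseteq> cols c x \<union> forb c w"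
  proof (rule ccontr)
    assume "\<not> ?thesis"
    then obtain \<alpha> where al: "\<alpha> \<in> {1..5}" "\<alpha> \<notin> cols c x" "\<alpha> \<notin> forb c w" by blast
    have a0: "\<alpha> \<noteq> 0" "\<alpha> \<le> 5" using al by auto
    have "state {} {z} (c(y1 := \<alpha>))"
      by (rule state_colour[OF y1(3) a0(1) st y1(2) a0(2) valy[OF al(1)] safey[OF al(1)]])
        (use w al fx in auto)
    moreover have "sole_pair (c(y1 := \<alpha>)) z v u"
      using sole_pair_upd[of c y1 \<alpha> z v u] y1(3) a0 pr zy1 by blast
    moreover have "udeg (c(y1 := \<alpha>)) z \<le> 1"
      using udeg_upd[of c y1 \<alpha> z] y1(3) a0 d by simp
    moreover have "(c(y1 := \<alpha>)) z = 0" using y1(4) z by simp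
    moreover have "holes (c(y1 := \<alpha>)) < n" using holes_upd[of y1 c \<alpha>] y1 a0 h by linarith
    ultimately have completable using defect_done[OF IH _ _ z(1)] by blast
    then show False using contra by blast
  qed
  then have "card {1..5::nat} \<le> card (cols c x \<union> forb c w)" by (intro card_mono) simp_all
  moreover have "card (cols c x \<union> forb c w) + card (cols c x \<inter> forb c w) = card (cols c x) + card (forb c w)"
    using card_Un_Int[of "cols c x" "forb c w"] by simp
  ultimately have "card (cols c x \<inter> forb c w) = 0"
    using cx forb_cases(1)[OF wr] by (simp only: card_atLeastAtMost)
  then have disj: "cols c x \<inter> forb c w = {}" by simp

  obtain \<beta> \<beta>' where bb: "cols c x = {\<beta>, \<beta>'}" "\<beta> \<noteq> \<beta>'" using A2(1) Ax by (metis card_2_iff)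
  have b: "\<beta> \<in> ?A" "\<beta> \<in> cols c x" "\<beta> \<in> {1..5}" using bb Ax by blast+
  have b0: "\<beta> \<noteq> 0" "\<beta> \<le> 5" using b(3) by auto
  obtain t where t: "t \<in> nb x" "c t = \<beta>" using b(2) by (auto simp: cols_def)
  have tz: "t \<noteq> z" "t \<noteq> x" "t \<noteq> y1" "x \<in> nb t" using t b0 z(2) x(2) y1(3) nb_sym[of t x] by auto

  let ?cz = "c(z := \<beta>)"
  have st_z: "state {} {x} ?cz"
    by (rule state_colour[OF z(2) b0(1) st z(1) b0(2) valA[OF b(1)] safeA[OF b0(1)]]) (use W in auto)
  have czx: "?cz x = 0" using x by simp
  \<comment> \<open>Otherwise \<open>z\<close> could receive \<beta> and then \<open>x\<close>
    receive \<open>q\<close>: the only pair at \<open>x\<close> is \<open>z\<close>,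
    \<open>t\<close>, and \<open>q\<close> is forbidden neither at \<open>y1\<close> nor at
    \<open>y2\<close>.\<close>
  have blk_q: "q \<in> block ?cz x t" if q: "q \<in> cols c z - {p}" for q
  proof (rule ccontr)
    assume nb: "q \<notin> block ?cz x t"
    have q5: "q \<in> {1..5}" using q cols_sub[OF pc] by blast
    have q0: "q \<noteq> 0" using q5 by simp
    let ?d = "?cz(x := q)"
    obtain t' where t': "sole_pair ?cz x z t'"
      using rainbow_upd_pair[of c z \<beta> x, OF z(2) b0(1) x(6)] x(7) t z(2) b0
      unfolding rainbow_def by (metis fun_upd_apply tz(1))
    have "t = t'" using sole_pairD[OF t', of z t] x(7) t tz(1) b0 by auto
    have "valid ?d"
      using valid_pair[of ?cz x q z t'] czx q0 stateD(2)[OF st_z] t' nb \<open>t = t'\<close> by blast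
    moreover have "2 \<le> card (cols ?cz x) \<or> card (nb x) < 5"
    proof -
      have "cols c x \<subseteq> cols ?cz x" using cols_upd[of c z \<beta> x] z(2) b0 by auto
      then have "card (cols c x) \<le> card (cols ?cz x)" by (intro card_mono) simp_all
      then show ?thesis using A2(1) Ax by simp
    qed
    then have "safe ?d x" using safe_new[of ?cz x q] czx q0 by blast
    moreover have "holes ?cz \<le> n" using holes_upd[of z c \<beta>] z b0 h by linarith
    moreover have "q \<notin> forb ?cz y" if y: "y \<in> unc ?cz x" for y
    proof -
      have "y \<in> {y1, y2}" using y Wx unc_upd[of c z \<beta> x] z(2) b0 by auto
      then have "forb c y = insert p ?D" "z \<notin> nb y" "udeg c y = 2" using T ys(7)[of y] nb_sym[of z y] uy by auto
      moreover have "cols ?cz y = cols c y" "udeg ?cz y = udeg c y"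
        using cols_upd[of c z \<beta> y] udeg_upd[of c z \<beta> y] z(2) b0 \<open>z \<notin> nb y\<close> by simp_all
      ultimately show ?thesis using q by (auto simp: forb_def)
    qed
    ultimately have completable
      using harmless[OF IH _ st_z x(1) czx q5] by blast
    then show False using contra by blast
  qed

  let ?cy = "c(y1 := \<beta>)"
  have st_y: "state {} {x, z} ?cy"
    by (rule state_colour[OF y1(3) b0(1) st y1(2) b0(2) valy[OF b(3)] safey[OF b(3)]])
      (use w disj b(2) in auto)
  have cyx: "?cy x = 0" "?cy z = 0" using x z y1(4,5) by auto
  obtain t' where t': "sole_pair ?cy x y1 t'"
    using rainbow_upd_pair[of c y1 \<beta> x, OF y1(3) b0(1) x(6)] y1(9) t y1(3) b0
    unfolding rainbow_def by (metis fun_upd_apply tz(3))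
  have "t = t'" using sole_pairD[OF t', of y1 t] y1(9) t tz(3) b0 by auto
  then have spy: "sole_pair ?cy x y1 t" using t' by simp
  have spz: "sole_pair ?cy z v u" using sole_pair_upd[of c y1 \<beta> z v u] y1(3) b0 pr zy1 by blast
  have uzy: "udeg ?cy z = 1" using udeg_upd[of c y1 \<beta> z] y1(3) b0 d zy1 by simp
  have cyz: "cols ?cy z = cols c z" using cols_upd[of c y1 \<beta> z] y1(3) b0 zy1 by simp
  have hy: "holes ?cy < n" using holes_upd[of y1 c \<beta>] y1 b0 h by linarith
  \<comment> \<open>Likewise with \<beta> at \<open>y1\<close>, then \<delta> at \<open>x\<close>.
    The vertex \<open>z\<close> keeps just its pair and has no uncoloured neighbour left, and only
    \<open>y2\<close> may be damaged.\<close>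
  have blk_D: "\<delta> \<in> block ?cy x t" if dl: "\<delta> \<in> ?D" for \<delta>
  proof (rule ccontr)
    assume nb: "\<delta> \<notin> block ?cy x t"
    have d5: "\<delta> \<in> {1..5}" "\<delta> \<noteq> 0" using dl by auto
    let ?d = "?cy(x := \<delta>)"
    have vd: "valid ?d"
      using valid_pair[of ?cy x \<delta> y1 t] cyx d5 stateD(2)[OF st_y] spy nb by blast
    have "2 \<le> card (cols ?cy x) \<or> card (nb x) < 5"
    proof -
      have "cols c x \<subseteq> cols ?cy x" using cols_upd[of c y1 \<beta> x] y1(3) b0 by auto
      then have "card (cols c x) \<le> card (cols ?cy x)" by (intro card_mono) simp_all
      then show ?thesis using A2(1) Ax by simp
    qed
    then have sfd: "safe ?d x" using safe_new[of ?cy x \<delta>] cyx d5 by blast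
    have unx: "unc ?cy x = {z, y2}" using unc_upd[of c y1 \<beta> x] y1(3,4) b0 Wx Y(2) by auto
    have zd: "rainbow ?d z \<or> (udeg ?d z = 0 \<and> near_rainbow ?d z)"
    proof -
      have "sole_pair ?d z v u" using sole_pair_upd[of ?cy x \<delta> z v u] cyx d5 spz cyz dl by blast
      moreover have "udeg ?d z = 0" using udeg_upd[of ?cy x \<delta> z] cyx d5 uzy x(4) by simp
      ultimately show ?thesis by (auto simp: near_rainbow_def)
    qed
    have "udeg ?cy y2 \<le> 2" using udeg_upd[of c y1 \<beta> y2] y1(3) b0 uy by simp
    then have uy2: "udeg ?cy y2 = 2" if "\<delta> \<in> forb ?cy y2"
      using that by (auto simp: forb_def split: if_splits)
    have completable
    proof (rule harm[OF IH less_imp_le[OF hy] st_y x(1) cyx(1) d5(1) vd sfd, where x = y2])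
      show "rainbow ?d r \<or> (udeg ?d r = 0 \<and> near_rainbow ?d r)" if "r \<in> {x, z}" "r \<noteq> x" for r
      proof -
        have "r = z" using that by simp
        show ?thesis unfolding \<open>r = z\<close> by (rule zd)
      qed
      show "y2 \<in> unc ?cy x" "y2 \<notin> {x, z}" using unx y2(4,5) by simp_all
      show "\<delta> \<notin> forb ?cy r" if "r \<in> unc ?cy x" "r \<notin> {x, z}" "r \<noteq> y2" for r
        using that unx by blast
      show "udeg ?cy y2 = 2 \<or> udeg ?cy y2 = 3 \<and> card (cols_at ?cy y2 x) \<le> 2" if "\<delta> \<in> forb ?cy y2"
        using uy2[OF that] by simp
    qed
    then show False using contra by blast
  qed

  text \<open>The colours blocked at \<open>x\<close> by \<open>t\<close> determine the neighbours of \<open>t\<close>. In particular, \<open>t\<close> sees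
    no colour twice, so that it can be recoloured, which resolves the conflict at \<open>x\<close>.\<close>
  obtain q1 q2 where q: "cols c z - {p} = {q1, q2}" "q1 \<noteq> q2"
    using D2(2) pF by (metis card_2_iff card_Diff_singleton diff_Suc_1 eval_nat_numeral(3))
  obtain d1 d2 where dd: "?D = {d1, d2}" "d1 \<noteq> d2" using D2(1) by (meson card_2_iff)
  have qd: "q1 \<notin> ?D" "q2 \<notin> ?D" "q1 \<noteq> p" "q2 \<noteq> p" using q(1) by blast+
  obtain a1 a2 where a: "a1 \<in> nb t - {x}" "?cz a1 = q1" "a2 \<in> nb t - {x}" "?cz a2 = q2"
    using blk_q[of q1] blk_q[of q2] q(1) unfolding block_def by blast
  obtain e1 e2 where e: "e1 \<in> nb t - {x}" "?cy e1 = d1" "e2 \<in> nb t - {x}" "?cy e2 = d2"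
    using blk_D[of d1] blk_D[of d2] dd(1) unfolding block_def by blast
  have qd0: "q1 \<noteq> 0" "q2 \<noteq> 0" "d1 \<noteq> 0" "d2 \<noteq> 0"
  proof -
    have "q1 \<in> cols c z" "q2 \<in> cols c z" using q(1) by blast+
    then show "q1 \<noteq> 0" "q2 \<noteq> 0" by (auto simp: cols_def)
    have "d1 \<in> {1..5}" "d2 \<in> {1..5}" using dd(1) by blast+
    then show "d1 \<noteq> 0" "d2 \<noteq> 0" by simp_all
  qed
  have ay: "a1 \<noteq> y1" "a2 \<noteq> y1" using a qd0 y1(3,4) by auto
  \<comment> \<open>The exception arises because \<open>z\<close> has colour \<beta> in
    \<open>?cz\<close> but is uncoloured in \<open>?cy\<close>.\<close>
  have ca: "?cy a1 = q1 \<or> a1 = z" "?cy a2 = q2 \<or> a2 = z" using a ay by (metis fun_upd_apply)+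
  have qdn: "q1 \<noteq> d1" "q1 \<noteq> d2" "q2 \<noteq> d1" "q2 \<noteq> d2" using qd dd(1) by blast+
  have ez: "e1 \<noteq> z" "e2 \<noteq> z" using e cyx qd0 by auto
  have dist: "a1 \<noteq> a2" "e1 \<noteq> e2" "a1 \<noteq> e1" "a1 \<noteq> e2" "a2 \<noteq> e1" "a2 \<noteq> e2"
    using a e q(2) dd(2) ca qdn ez by metis+
  have N: "nb t - {x} = {a1, a2, e1, e2}"
  proof -
    have "card {a1, a2, e1, e2} = 4" using dist by simp
    moreover have "{a1, a2, e1, e2} \<subseteq> nb t - {x}" using a e by blast
    ultimately show ?thesis
      using card_seteq[of "nb t - {x}" "{a1, a2, e1, e2}"] card_others[OF tz(4)] by simp
  qed
  have nbt: "y = x \<or> y = a1 \<or> y = a2 \<or> y = e1 \<or> y = e2" if "y \<in> nb t" for y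
    using that N by blast
  have rt: "rainbow ?cy t"
    unfolding rainbow_def
  proof (intro ballI impI, rule ccontr)
    fix y y' assume yy: "y \<in> nb t" "y' \<in> nb t" "y \<noteq> y'" "?cy y = ?cy y'" "?cy y \<noteq> 0"
    then have "y \<noteq> x" "y' \<noteq> x" "y \<noteq> z" "y' \<noteq> z" using cyx by metis+
    then show False
      using nbt[OF yy(1)] nbt[OF yy(2)] yy(3,4) ca e q(2) dd(2) qdn by metis
  qed
  have ct: "?cy t = \<beta>" using t tz by simp
  have unct: "unc ?cy t \<subseteq> {x, z}"
  proof
    fix y assume "y \<in> unc ?cy t"
    then have "y \<in> nb t" "?cy y = 0" by (auto simp: unc_def)
    then show "y \<in> {x, z}" using nbt[of y] ca e qd0 by auto
  qed
  \<comment> \<open>The new colour of \<open>t\<close> must resolve the pair at \<open>x\<close>,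
    create none at \<open>z\<close>, and keep neighbours of that colour safe. A colour of
    \<open>?D\<close> missing at \<open>x\<close> qualifies, since its being blocked supplies a
    neighbour of colour \<beta>. If there is none, \<open>?D\<close> equals \<open>cols c x\<close>;
    then \<open>t\<close> is not adjacent to \<open>z\<close>, and \<open>p\<close> qualifies, being
    absent around \<open>x\<close> and \<open>t\<close>.\<close>
  have "\<exists>\<epsilon>\<in>{1..5}. \<epsilon> \<notin> cols c x \<and> (t \<in> nb z \<longrightarrow> \<epsilon> \<notin> cols c z)
      \<and> (\<forall>y\<in>nb t. ?cy y = \<epsilon> \<longrightarrow> (\<exists>y'\<in>nb y - {t}. ?cy y' \<noteq> 0 \<and> ?cy y' \<noteq> \<epsilon>))"
  proof (cases "?D \<subseteq> cols c x")
    case False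
    then obtain \<epsilon> where ep: "\<epsilon> \<in> ?D" "\<epsilon> \<notin> cols c x" by blast
    have eb: "\<epsilon> \<noteq> \<beta>" using ep(2) b(2) by blast
    have "\<exists>y'\<in>nb y - {t}. ?cy y' \<noteq> 0 \<and> ?cy y' \<noteq> \<epsilon>" if y: "y \<in> nb t" "?cy y = \<epsilon>" for y
    proof -
      have e0: "\<epsilon> \<noteq> 0" using ep(1) by auto
      obtain y0 y' where y0: "y0 \<in> nb t" "?cy y0 = \<epsilon>" "y' \<in> nb y0 - {t}" "?cy y' = \<beta>"
        using blk_D[OF ep(1)] eb ct unfolding block_def by force
      have "y0 = y" using rainbowD[OF rt y0(1) y(1)] y0(2) y(2) e0 by simp
      then show ?thesis using y0 eb b0 by metis
    qed
    then show ?thesis using ep by blast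
  next
    case True
    then have "?D = cols c x" using card_seteq[OF finite_sets(2) True] D2 A2 Ax by simp
    then have "p \<notin> cols c x" "t \<notin> nb z" using pD b(2) t b0 by (auto simp: cols_def)
    moreover have "?cy y \<noteq> p" if "y \<in> nb t" for y
    proof -
      have "d1 \<noteq> p" "d2 \<noteq> p" using dd(1) pD by blast+
      then show ?thesis using nbt[OF that] ca e(2,4) qd(3,4) cyx vu(4) by metis
    qed
    ultimately show ?thesis using p5 by blast
  qed
  then obtain \<epsilon> where ep: "\<epsilon> \<in> {1..5}" "\<epsilon> \<notin> cols c x" "t \<in> nb z \<Longrightarrow> \<epsilon> \<notin> cols c z"
    "\<And>y. y \<in> nb t \<Longrightarrow> ?cy y = \<epsilon> \<Longrightarrow> \<exists>y'\<in>nb y - {t}. ?cy y' \<noteq> 0 \<and> ?cy y' \<noteq> \<epsilon>" by blast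
  have e0: "\<epsilon> \<noteq> 0" "\<epsilon> \<le> 5" using ep(1) by auto
  let ?f = "?cy(t := \<epsilon>)"
  have "\<exists>y\<in>nb t. ?cy y \<noteq> 0 \<and> ?cy y \<noteq> \<epsilon>" using e dd(2) qd0 by (metis DiffD1)
  then have "state {} {x, z} ?f"
    using state_recolour[OF st_y _ rt e0] ct b0 ep(4) unct by simp
  then have st_f: "state {} {z} ?f"
  proof (rule state_drop)
    fix w' assume "w' \<in> {x, z}" "w' \<notin> {z}"
    have "rainbow ?f x"
      unfolding rainbow_def
    proof (intro ballI impI, rule ccontr)
      fix y y' assume yy: "y \<in> nb x" "y' \<in> nb x" "y \<noteq> y'" "?f y = ?f y'" "?f y \<noteq> 0"
      have ne: "?cy r \<noteq> \<epsilon>" if "r \<in> nb x" for r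
        using ep(2) e0 b(2) that by (auto simp: cols_def)
      then have nt: "y \<noteq> t" "y' \<noteq> t" using yy by (metis fun_upd_apply)+
      then have "?cy y = ?cy y'" "?cy y \<noteq> 0" using yy by simp_all
      then show False using sole_pairD[OF spy yy(1-3)] nt by blast
    qed
    then show "rainbow ?f w' \<or> (udeg ?f w' = 0 \<and> near_rainbow ?f w')"
      using \<open>w' \<in> {x, z}\<close> \<open>w' \<notin> {z}\<close> by simp
  qed
  have uncf: "unc ?f z = unc ?cy z" using ct b0 e0 by (auto simp: unc_def)
  have fz: "?f z = 0" using cyx tz by simp
  \<comment> \<open>If \<open>t\<close> belongs to the pair at \<open>z\<close>, recolouring it
    dissolves that pair; otherwise the pair remains the only one.\<close>
  have fin: "rainbow ?f z \<or> (\<exists>v u. sole_pair ?f z v u \<and> (udeg ?f z \<le> 1 \<or> udeg ?f z = 2 \<and> card (cols_at ?f z v) \<le> 2))"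
  proof (cases "t = v \<or> t = u")
    case True
    then have tn: "t \<in> nb z" using vu by blast
    have "rainbow ?f z"
      unfolding rainbow_def
    proof (intro ballI impI, rule ccontr)
      fix y y' assume yy: "y \<in> nb z" "y' \<in> nb z" "y \<noteq> y'" "?f y = ?f y'" "?f y \<noteq> 0"
      have ne: "?cy r \<noteq> \<epsilon>" if "r \<in> nb z" for r
        using ep(3)[OF tn] e0 that cyz by (auto simp: cols_def)
      then have nt: "y \<noteq> t" "y' \<noteq> t" using yy by (metis fun_upd_apply)+
      then have "?cy y = ?cy y'" "?cy y \<noteq> 0" using yy by simp_all
      then show False using sole_pairD[OF spz yy(1-3)] nt True by blast
    qed
    then show ?thesis by blast
  next
    case False
    have "sole_pair ?f z v u"
      unfolding sole_pair_def
    proof (intro conjI ballI impI)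
      show "v \<in> nb z" "u \<in> nb z" "v \<noteq> u" "?f v = ?f u" "?f v \<noteq> 0"
        using spz False by (auto simp: sole_pair_def)
      fix y y' assume yy: "y \<in> nb z" "y' \<in> nb z" "y \<noteq> y'" "?f y = ?f y'" "?f y \<noteq> 0"
      have "y \<noteq> t \<and> y' \<noteq> t"
      proof (rule ccontr)
        assume "\<not> ?thesis"
        then have tn: "t \<in> nb z" using yy by blast
        have ne: "?cy r \<noteq> \<epsilon>" if "r \<in> nb z" for r
          using ep(3)[OF tn] e0 that cyz by (auto simp: cols_def)
        then show False using yy \<open>\<not> (y \<noteq> t \<and> y' \<noteq> t)\<close> by (metis fun_upd_apply)
      qed
      then have "?cy y = ?cy y'" "?cy y \<noteq> 0" using yy by simp_all
      then show "y = v \<and> y' = u \<or> y = u \<and> y' = v" using sole_pairD[OF spz yy(1-3)] by blast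
    qed
    moreover have "udeg ?f z \<le> 1" using uzy uncf by (simp add: udeg_def)
    ultimately show ?thesis by blast
  qed
  have "holes ?f < n"
  proof -
    have "{r \<in> V. ?f r = 0} \<subseteq> {r \<in> V. ?cy r = 0}" using e0 by auto
    then have "holes ?f \<le> holes ?cy" unfolding holes_def using finite_V by (intro card_mono) simp_all
    then show ?thesis using hy by linarith
  qed
  then have completable using defect_done[OF IH _ st_f z(1) fz fin] by blast
  then show False using contra by blast
qed

section \<open>Existence of the colouring and translation to cycles given by lists\<close>

text \<open>A defect without uncoloured neighbours is tolerated by \<open>state {} {}\<close>, so
  \<open>defect_one\<close> and \<open>defect_two\<close> cover the remaining cases.\<close>

lemma complete_below_all: "complete_below n"
proof (induction n)
  case 0
  then show ?case by (simp add: complete_below_def)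
next
  case (Suc n)
  show ?case
    unfolding complete_below_def
  proof (intro allI impI)
    fix c assume "holes c < Suc n" and "state {} {} c \<or> (\<exists>z. defect c z)"
    then have h: "holes c \<le> n" by simp
    show completable
      using \<open>state {} {} c \<or> (\<exists>z. defect c z)\<close>
    proof (elim disjE exE)
      assume "state {} {} c"
      then show completable by (rule complete_no_defect[OF Suc h])
    next
      fix z assume "defect c z"
      then obtain v u where z: "state {} {z} c" "z \<in> V" "c z = 0" "sole_pair c z v u"
        and ud: "udeg c z \<le> 1 \<or> udeg c z = 2 \<and> card (cols_at c z v) \<le> 2"
        unfolding defect_def by blast
      consider "udeg c z = 0" | "udeg c z = 1" | "udeg c z = 2" "card (cols_at c z v) \<le> 2"
        using ud by linarith
      then show completable
      proof cases
        case 1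
        have "state {} {} c"
          by (rule state_drop[OF z(1)]) (use 1 z(4) in \<open>auto simp: near_rainbow_def\<close>)
        then show ?thesis by (rule complete_no_defect[OF Suc h])
      next
        case 2
        then show ?thesis by (rule defect_one[OF Suc h z])
      next
        case 3
        then show ?thesis by (rule defect_two[OF Suc h z])
      qed
    qed
  qed
qed

lemma exists_colouring: completable
proof -
  have "valid (\<lambda>_. 0)" by (simp add: valid_def bad_cycle_def)
  then have "state {} {} (\<lambda>_. 0)"
    by (simp add: state_def partial_col_def rainbow_def)
  then show ?thesis
    using complete_below_all[of "Suc (holes (\<lambda>_. 0))"] unfolding complete_below_def by blast
qed

text \<open>\<open>E'\<close> stands for the edges within one colour or between two colours. In both
  cases a walk of two edges returns to the same colour.\<close>

lemma bad_cycle_of_list: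
  assumes xs: "3 \<le> length xs" "distinct xs"
    and edge: "\<And>i. Suc i < length xs \<Longrightarrow> E' (xs ! i) (xs ! Suc i)" "E' (last xs) (hd xs)"
    and E': "\<And>a b. E' a b \<Longrightarrow> E a b" "\<And>a b b'. E' a b \<Longrightarrow> E' b b' \<Longrightarrow> c a = c b'" "\<And>a b. E' a b \<Longrightarrow> c a \<noteq> 0"
  shows "\<not> valid c"
proof -
  let ?n = "length xs"
  define f where "f = (\<lambda>i. xs ! (i mod ?n))"
  have n0: "?n > 0" using xs by linarith
  have step: "E' (f i) (f (Suc i))" for i
  proof (cases "Suc (i mod ?n) < ?n")
    case True
    then have "Suc i mod ?n = Suc (i mod ?n)" by (simp add: mod_Suc)
    then show ?thesis using edge(1)[OF True] by (simp add: f_def)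
  next
    case False
    then have "Suc (i mod ?n) = ?n" using n0 by (simp add: Suc_leI le_antisym)
    then have "i mod ?n = ?n - 1" "Suc i mod ?n = 0" by (simp_all add: mod_Suc)
    then have "f i = last xs" "f (Suc i) = hd xs"
      using n0 by (simp_all add: f_def last_conv_nth hd_conv_nth)
    then show ?thesis using edge(2) by simp
  qed
  have "bad_cycle c ?n f"
    unfolding bad_cycle_def
  proof (intro conjI allI)
    show "3 \<le> ?n" using xs by simp
    show "f (i + ?n) = f i" for i by (simp add: f_def)
    show "inj_on f {..<?n}" using xs(2) by (auto simp: inj_on_def f_def nth_eq_iff_index_eq)
    show "f (Suc i) \<in> nb (f i)" for i using E'(1)[OF step] by (simp add: nb_def)
    show "c (f (i + 2)) = c (f i)" for i using E'(2)[OF step step, of i] by simp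
    show "c (f i) \<noteq> 0" for i using E'(3)[OF step] .
  qed
  then show ?thesis by (auto simp: valid_def)
qed

end

theorem mainTheorem4:
  fixes V :: "'a set" and E :: "'a \<Rightarrow> 'a \<Rightarrow> bool"
  assumes "simple_graph V E" and "max_degree_le V E 5"
  shows "\<exists>c :: 'a \<Rightarrow> nat. (\<forall>v\<in>V. c v \<in> {1..5})
     \<and> (\<forall>i\<in>{1..5}. acyclic_graph (colour_class V c i) (class_edges E c i)
                 \<and> max_degree_le (colour_class V c i) (class_edges E c i) 4)
     \<and> (\<forall>i\<in>{1..5}. \<forall>j\<in>{1..5}. i \<noteq> j \<longrightarrow> acyclic_graph V (bicolour_edges E c i j))"
proof -
  interpret degree5_graph V E by unfold_locales (use assms in auto)
  obtain c where c: "partial_col c" and col: "\<And>v. v \<in> V \<Longrightarrow> c v \<noteq> 0" and sf: "\<And>v. v \<in> V \<Longrightarrow> safe c v"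
    using exists_colouring unfolding completable_def by blast
  have val: "valid c" and c5: "c v \<le> 5" for v using c by (auto simp: partial_col_def)
  have EV: "E a b \<Longrightarrow> c a \<noteq> 0" for a b
    using col nb_V' unfolding nb_def by blast
  have mono: "acyclic_graph U (class_edges E c i)" for U i
    unfolding acyclic_graph_def has_cycle_def
  proof (rule notI, elim exE conjE)
    fix xs assume "3 \<le> length xs" "distinct xs" "class_edges E c i (last xs) (hd xs)"
      "\<forall>k. Suc k < length xs \<longrightarrow> class_edges E c i (xs ! k) (xs ! Suc k)"
    then have "\<not> valid c"
      by (intro bad_cycle_of_list[where E' = "class_edges E c i" and xs = xs])
        (auto simp: class_edges_def dest: EV)
    then show False using val by simp
  qed
  have bi: "acyclic_graph U (bicolour_edges E c i j)" if "i \<noteq> j" for U i j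
    unfolding acyclic_graph_def has_cycle_def
  proof (rule notI, elim exE conjE)
    fix xs assume "3 \<le> length xs" "distinct xs" "bicolour_edges E c i j (last xs) (hd xs)"
      "\<forall>k. Suc k < length xs \<longrightarrow> bicolour_edges E c i j (xs ! k) (xs ! Suc k)"
    then have "\<not> valid c"
      by (intro bad_cycle_of_list[where E' = "bicolour_edges E c i j" and xs = xs])
        (use that in \<open>auto simp: bicolour_edges_def dest: EV\<close>)
    then show False using val by simp
  qed
  have deg: "max_degree_le (colour_class V c i) (class_edges E c i) 4" for i
    unfolding max_degree_le_def
  proof
    fix v assume v: "v \<in> colour_class V c i"
    then have vi: "v \<in> V" "c v = i" by (auto simp: colour_class_def)
    let ?S = "{w \<in> colour_class V c i. class_edges E c i v w}"
    have S: "?S \<subseteq> {w \<in> nb v. c w = c v}"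
      using vi by (auto simp: class_edges_def nb_def)
    \<comment> \<open>At degree 5, safety supplies a neighbour of another colour, leaving at most
      four in the class of \<open>v\<close>.\<close>
    show "card ?S \<le> 4"
    proof (cases "card (nb v) < 5")
      case True
      have "card ?S \<le> card (nb v)" using S by (intro card_mono) auto
      then show ?thesis using True by linarith
    next
      case False
      then obtain w where w: "w \<in> nb v" "c w \<noteq> c v" using sf[OF vi(1)] by (auto simp: safe_def)
      then have "?S \<subseteq> nb v - {w}" using S by blast
      then have "card ?S \<le> card (nb v - {w})" by (intro card_mono) auto
      also have "\<dots> \<le> 4" using w(1) card_nb[of v] by simp
      finally show ?thesis .
    qed
  qed
  have "\<forall>v\<in>V. c v \<in> {1..5}" using col c5 by (simp add: Suc_le_eq)
  then show ?thesis using mono bi deg by blast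
qed

end
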